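(* For $N\ge1$ let $J_N$ be the optimal value of $$\min_{\mu_0,\dots,\mu_{N-1}}\ \frac1N\sum_{k=0}^{N-1}\mathbf{E}\{z_k^Tz_k\}$$ subject to, for all $k$, $$x_{k+1}=\Big(A+\sum_{i=1}^M\sigma_k(i)A_i\Big)x_k+Bu_k+w_k,\quad x_0=0,\quad z_k=Cx_k+Du_k,\quad u_k=\mu_k(x_0,\dots,x_k).$$ Then $\lim_{N\to\infty}J_N$ is equal to the optimal value (taken to be $+\infty$ if infeasible) of $$\min_{V\succeq0}\ \mathbf{Tr}\left(\begin{bmatrix}C&D\end{bmatrix}V\begin{bmatrix}C&D\end{bmatrix}^T\right)\quad\text{s.t.}\quad FVF^T=\begin{bmatrix}A&B\end{bmatrix}V\begin{bmatrix}A&B\end{bmatrix}^T+\sum_{i=1}^MA_iFVF^TA_i^T+I,$$ where $F=\begin{bmatrix}I_n&0\end{bmatrix}\in\mathbb{R}^{n\times(n+m)}$ and $V$ ranges over real symmetric $(n+m)\times(n+m)$ matrices. Furthermore, if $$V^\star=\begin{bmatrix}X^\star&R^\star\\(R^\star)^T&U^\star\end{bmatrix}$$ (with $X^\star\in\mathbb{R}^{n\times n}$) is an optimal solution of this semidefinite program, then $X^\star\succ0$ and the stationary controller $$u_k=(R^\star)^T(X^\star)^{-1}x_k$$ is optimal for the control problem as $N\to\infty$, i.e. under this controller $\frac1N\sum_{k=0}^{N-1}\mathbf{E}\{z_k^Tz_k\}$ converges to $\lim_{N\to\infty}J_N$ as $N\to\infty$.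
   Context: Here $x_k\in\mathbb{R}^n$, $u_k\in\mathbb{R}^m$, and $A,A_1,\dots,A_M\in\mathbb{R}^{n\times n}$, $B\in\mathbb{R}^{n\times m}$, $C$, $D$ are given real matrices with $\begin{bmatrix}C&D\end{bmatrix}^T\begin{bmatrix}C&D\end{bmatrix}\succ0$. The noises $w_k\in\mathbb{R}^n$ and $\sigma_k(i)\in\mathbb{R}$ ($k\ge0$, $1\le i\le M$) are zero-mean, square-integrable, mutually independent (over all $k$ and $i$), with arbitrary probability distributions, $\mathbf{E}\{w_kw_k^T\}=I$ and $\mathbf{E}\{\sigma_k(i)^2\}=1$. Admissible controllers are (possibly nonlinear) measurable causal state-feedback maps $\mu_k$ for which $u_k$ has finite second moments. $S\succeq0$ ($\succ0$) means symmetric positive semidefinite (definite); $\mathbf{Tr}$ is the trace. "Optimal value" means infimum. *)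

theory Defs
  imports "HOL-Probability.Probability"
begin

definition pos_semidef :: "real^'k^'k \<Rightarrow> bool" where
  "pos_semidef S \<longleftrightarrow> transpose S = S \<and> (\<forall>x. 0 \<le> x \<bullet> (S *v x))"

definition pos_def :: "real^'k^'k \<Rightarrow> bool" where
  "pos_def S \<longleftrightarrow> transpose S = S \<and> (\<forall>x. x \<noteq> 0 \<longrightarrow> 0 < x \<bullet> (S *v x))"

text \<open>Block matrices are indexed by sum types: \<open>'n + 'm\<close> is the index type of
  \<open>\<real>\<^sup>n \<times> \<real>\<^sup>m\<close>, with \<open>Inl\<close> selecting the first block.\<close>

definition hcat :: "real^'n^'p \<Rightarrow> real^'m^'p \<Rightarrow> real^('n + 'm)^'p" where
  "hcat P Q = (\<chi> i j. case j of Inl a \<Rightarrow> P $ i $ a | Inr b \<Rightarrow> Q $ i $ b)"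

definition vcat :: "real^'k^'p \<Rightarrow> real^'k^'q \<Rightarrow> real^'k^('p + 'q)" where
  "vcat P Q = (\<chi> i. case i of Inl a \<Rightarrow> P $ a | Inr b \<Rightarrow> Q $ b)"

definition outer :: "real^'n \<Rightarrow> real^'m \<Rightarrow> real^'m^'n" where
  "outer x y = (\<chi> i j. x $ i * y $ j)"

text \<open>The family to be mutually independent mixes vector-valued and scalar variables, so
  independence is stated for the generated \<open>\<sigma>\<close>-algebras; \<open>Inl k\<close> stands for \<open>w\<^sub>k\<close> and
  \<open>Inr (k, i)\<close> for \<open>\<sigma>\<^sub>k(i)\<close>.\<close>

definition independent_noise ::
  "'a measure \<Rightarrow> nat \<Rightarrow> (nat \<Rightarrow> 'a \<Rightarrow> real^'n) \<Rightarrow> (nat \<Rightarrow> nat \<Rightarrow> 'a \<Rightarrow> real) \<Rightarrow> bool"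
where
  "independent_noise P M w \<sigma> \<longleftrightarrow>
     prob_space.indep_sets P
       (case_sum (\<lambda>k. {w k -` S \<inter> space P | S. S \<in> sets borel})
                 (\<lambda>(k, i). {\<sigma> k i -` S \<inter> space P | S. S \<in> sets borel}))
       (UNIV <+> (UNIV \<times> {1..M}))"

text \<open>A policy \<open>\<mu>\<close> gives at time \<open>k\<close> a map on histories \<open>(x\<^sub>0, \<dots>, x\<^sub>k)\<close>, represented as
  functions on \<open>{..k}\<close> that are \<open>undefined\<close> elsewhere (elements of the product space used in
  \<open>admissible\<close> below).  \<open>history\<close> is the history produced by noise realisations
  \<open>v\<close> (additive) and \<open>s\<close> (multiplicative).\<close>

type_synonym ('n, 'm) policy = "nat \<Rightarrow> (nat \<Rightarrow> real^'n) \<Rightarrow> real^'m"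

primrec history ::
  "real^'n^'n \<Rightarrow> real^'m^'n \<Rightarrow> nat \<Rightarrow> (nat \<Rightarrow> real^'n^'n) \<Rightarrow> ('n, 'm) policy
     \<Rightarrow> (nat \<Rightarrow> real^'n) \<Rightarrow> (nat \<Rightarrow> nat \<Rightarrow> real) \<Rightarrow> nat \<Rightarrow> nat \<Rightarrow> real^'n"
where
  "history A B M As \<mu> v s 0 = (\<lambda>j\<in>{..0}. 0)"
| "history A B M As \<mu> v s (Suc k) =
     (let h = history A B M As \<mu> v s k in
        h(Suc k := (A + (\<Sum>i=1..M. s k i *\<^sub>R As i)) *v h k + B *v \<mu> k h + v k))"

definition state ::
  "real^'n^'n \<Rightarrow> real^'m^'n \<Rightarrow> nat \<Rightarrow> (nat \<Rightarrow> real^'n^'n) \<Rightarrow> (nat \<Rightarrow> 'a \<Rightarrow> real^'n)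
     \<Rightarrow> (nat \<Rightarrow> nat \<Rightarrow> 'a \<Rightarrow> real) \<Rightarrow> ('n, 'm) policy \<Rightarrow> nat \<Rightarrow> 'a \<Rightarrow> real^'n"
where
  "state A B M As w \<sigma> \<mu> k \<omega> = history A B M As \<mu> (\<lambda>k. w k \<omega>) (\<lambda>k i. \<sigma> k i \<omega>) k k"

definition input ::
  "real^'n^'n \<Rightarrow> real^'m^'n \<Rightarrow> nat \<Rightarrow> (nat \<Rightarrow> real^'n^'n) \<Rightarrow> (nat \<Rightarrow> 'a \<Rightarrow> real^'n)
     \<Rightarrow> (nat \<Rightarrow> nat \<Rightarrow> 'a \<Rightarrow> real) \<Rightarrow> ('n, 'm) policy \<Rightarrow> nat \<Rightarrow> 'a \<Rightarrow> real^'m"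
where
  "input A B M As w \<sigma> \<mu> k \<omega> = \<mu> k (\<lambda>j\<in>{..k}. state A B M As w \<sigma> \<mu> j \<omega>)"

lemma history_eq_restrict:
  "history A B M As \<mu> v s k = (\<lambda>j\<in>{..k}. history A B M As \<mu> v s j j)"
proof
  let ?h = "history A B M As \<mu> v s"
  have step: "?h (Suc k) j = ?h k j" if "j \<noteq> Suc k" for k j
    using that by (simp add: Let_def)
  have "?h k j = (if j \<le> k then ?h j j else undefined)" for k j
  proof (induction k)
    case 0
    show ?case by simp
  next
    case (Suc k)
    show ?case
    proof (cases "j = Suc k")
      case True
      show ?thesis unfolding True by (simp only: le_refl if_True)
    next
      case False
      then have "j \<le> Suc k \<longleftrightarrow> j \<le> k" by auto
      with step[OF False] Suc.IH show ?thesis by (simp only:)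
    qed
  qed
  then show "?h k j = (\<lambda>j\<in>{..k}. ?h j j) j" for j
    unfolding restrict_def atMost_iff by blast
qed

lemma state_0: "state A B M As w \<sigma> \<mu> 0 \<omega> = 0"
  by (simp add: state_def)

lemma state_Suc:
  "state A B M As w \<sigma> \<mu> (Suc k) \<omega> =
     (A + (\<Sum>i=1..M. \<sigma> k i \<omega> *\<^sub>R As i)) *v state A B M As w \<sigma> \<mu> k \<omega>
       + B *v input A B M As w \<sigma> \<mu> k \<omega> + w k \<omega>"
proof -
  let ?h = "history A B M As \<mu> (\<lambda>k. w k \<omega>) (\<lambda>k i. \<sigma> k i \<omega>)"
  have "input A B M As w \<sigma> \<mu> k \<omega> = \<mu> k (?h k)"
    unfolding input_def state_def history_eq_restrict[symmetric] by (rule refl)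
  then show ?thesis
    by (simp add: state_def Let_def)
qed

definition admissible ::
  "'a measure \<Rightarrow> real^'n^'n \<Rightarrow> real^'m^'n \<Rightarrow> nat \<Rightarrow> (nat \<Rightarrow> real^'n^'n)
     \<Rightarrow> (nat \<Rightarrow> 'a \<Rightarrow> real^'n) \<Rightarrow> (nat \<Rightarrow> nat \<Rightarrow> 'a \<Rightarrow> real) \<Rightarrow> nat \<Rightarrow> ('n, 'm) policy \<Rightarrow> bool"
where
  "admissible P A B M As w \<sigma> N \<mu> \<longleftrightarrow>
     (\<forall>k<N. \<mu> k \<in> borel_measurable (Pi\<^sub>M {..k} (\<lambda>_. borel)) \<and>
            integrable P (\<lambda>\<omega>. (norm (input A B M As w \<sigma> \<mu> k \<omega>))\<^sup>2))"

definition average_cost ::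
  "'a measure \<Rightarrow> real^'n^'n \<Rightarrow> real^'m^'n \<Rightarrow> real^'n^'p \<Rightarrow> real^'m^'p \<Rightarrow> nat
     \<Rightarrow> (nat \<Rightarrow> real^'n^'n) \<Rightarrow> (nat \<Rightarrow> 'a \<Rightarrow> real^'n) \<Rightarrow> (nat \<Rightarrow> nat \<Rightarrow> 'a \<Rightarrow> real)
     \<Rightarrow> nat \<Rightarrow> ('n, 'm) policy \<Rightarrow> real"
where
  "average_cost P A B C D M As w \<sigma> N \<mu> =
     (1 / real N) * (\<Sum>k<N. \<integral>\<omega>. (let z = C *v state A B M As w \<sigma> \<mu> k \<omega>
                                        + D *v input A B M As w \<sigma> \<mu> k \<omega> in z \<bullet> z) \<partial>P)"

definition optimal_cost ::
  "'a measure \<Rightarrow> real^'n^'n \<Rightarrow> real^'m^'n \<Rightarrow> real^'n^'p \<Rightarrow> real^'m^'p \<Rightarrow> nat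
     \<Rightarrow> (nat \<Rightarrow> real^'n^'n) \<Rightarrow> (nat \<Rightarrow> 'a \<Rightarrow> real^'n) \<Rightarrow> (nat \<Rightarrow> nat \<Rightarrow> 'a \<Rightarrow> real)
     \<Rightarrow> nat \<Rightarrow> ereal"
where
  "optimal_cost P A B C D M As w \<sigma> N =
     (INF \<mu>\<in>{\<mu>. admissible P A B M As w \<sigma> N \<mu>}.
        ereal (average_cost P A B C D M As w \<sigma> N \<mu>))"

definition linear_policy :: "real^'n^'m \<Rightarrow> ('n, 'm) policy" where
  "linear_policy K k h = K *v h k"

definition sdp_feasible ::
  "real^'n^'n \<Rightarrow> real^'m^'n \<Rightarrow> nat \<Rightarrow> (nat \<Rightarrow> real^'n^'n) \<Rightarrow> real^('n + 'm)^('n + 'm) \<Rightarrow> bool"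
where
  "sdp_feasible A B M As V \<longleftrightarrow>
     pos_semidef V \<and>
     (let F = hcat (mat 1 :: real^'n^'n) (0 :: real^'m^'n) in
        F ** V ** transpose F =
          hcat A B ** V ** transpose (hcat A B)
          + (\<Sum>i=1..M. As i ** F ** V ** transpose F ** transpose (As i)) + mat 1)"

definition sdp_objective ::
  "real^'n^'p \<Rightarrow> real^'m^'p \<Rightarrow> real^('n + 'm)^('n + 'm) \<Rightarrow> real"
where
  "sdp_objective C D V = trace (hcat C D ** V ** transpose (hcat C D))"

text \<open>In \<open>ereal\<close> the infimum over the empty set is \<open>\<infinity>\<close>.\<close>

definition sdp_value ::
  "real^'n^'n \<Rightarrow> real^'m^'n \<Rightarrow> real^'n^'p \<Rightarrow> real^'m^'p \<Rightarrow> nat \<Rightarrow> (nat \<Rightarrow> real^'n^'n) \<Rightarrow> ereal"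
where
  "sdp_value A B C D M As =
     (INF V\<in>{V. sdp_feasible A B M As V}. ereal (sdp_objective C D V))"

definition sdp_optimal ::
  "real^'n^'n \<Rightarrow> real^'m^'n \<Rightarrow> real^'n^'p \<Rightarrow> real^'m^'p \<Rightarrow> nat \<Rightarrow> (nat \<Rightarrow> real^'n^'n)
     \<Rightarrow> real^('n + 'm)^('n + 'm) \<Rightarrow> bool"
where
  "sdp_optimal A B C D M As V \<longleftrightarrow>
     sdp_feasible A B M As V \<and>
     (\<forall>V'. sdp_feasible A B M As V' \<longrightarrow> sdp_objective C D V \<le> sdp_objective C D V')"

end

theory Submission
  imports Defs
begin

text \<open>Let \<open>V\<^sub>k\<close> be the second moment matrix of \<open>(x\<^sub>k, u\<^sub>k)\<close> and \<open>X\<^sub>k = F V\<^sub>k F\<^sup>T\<close>. Since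
  \<open>(x\<^sub>k, u\<^sub>k)\<close> is independent of the noise at time \<open>k\<close>, \<open>X\<^sub>k\<^sub>+\<^sub>1 = \<Phi>(V\<^sub>k)\<close>, where \<open>\<Phi>\<close> is the
  monotone affine right-hand side of the semidefinite constraint, and the cost at time \<open>k\<close> is the
  objective at \<open>V\<^sub>k\<close>.

  A feasible \<open>V\<close> with blocks \<open>X, R, U\<close> dominates \<open>[I; K] X [I; K]\<^sup>T\<close> for \<open>K = R\<^sup>T X\<^sup>-\<^sup>1\<close>, so under
  \<open>u = K x\<close> monotonicity keeps \<open>X\<^sub>k \<le> X\<close> and every stage costs at most the objective at \<open>V\<close>.

  Conversely, the average of \<open>V\<^sub>0, \<dots>, V\<^sub>T\<^sub>-\<^sub>1\<close> solves the constraint up to \<open>X\<^sub>T / T\<close>. If cheap policies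
  exist for arbitrarily long horizons \<open>N\<close>, then some \<open>T\<close> near \<open>N\<close> makes this error small, and by
  compactness these averages accumulate at a feasible \<open>V\<close> that is just as cheap.\<close>

subsection \<open>Loewner order and block matrices\<close>

text \<open>The way second moments transform under a linear map; the constraint and the objective
  are both assembled from it.\<close>

definition congr :: "real^'k^'l \<Rightarrow> real^'k^'k \<Rightarrow> real^'l^'l" where
  "congr S V = S ** V ** transpose S"

text \<open>Only quadratic forms are compared, so this is a preorder on all square matrices,
  symmetric or not.\<close>

definition loewner_le :: "real^'k^'k \<Rightarrow> real^'k^'k \<Rightarrow> bool" where
  "loewner_le S T \<longleftrightarrow> (\<forall>x. x \<bullet> (S *v x) \<le> x \<bullet> (T *v x))"

definition join :: "real^'n \<Rightarrow> real^'m \<Rightarrow> real^('n + 'm)" where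
  "join x u = (\<chi> i. case i of Inl a \<Rightarrow> x $ a | Inr b \<Rightarrow> u $ b)"

lemma inner_congr: "x \<bullet> (congr S V *v y) = (x v* S) \<bullet> (V *v (y v* S))"
  unfolding congr_def
  by (simp add: matrix_vector_mul_assoc[symmetric] dot_lmul_matrix)

lemma loewner_le_refl: "loewner_le S S"
  by (simp add: loewner_le_def)

lemma loewner_le_trans: "loewner_le S T \<Longrightarrow> loewner_le T W \<Longrightarrow> loewner_le S W"
  unfolding loewner_le_def by (meson order_trans)

lemma loewner_le_add:
  "loewner_le S T \<Longrightarrow> loewner_le S' T' \<Longrightarrow> loewner_le (S + S') (T + T')"
  unfolding loewner_le_def
  by (auto simp: matrix_vector_mult_add_rdistrib inner_add_right intro: add_mono)

lemma loewner_le_sum: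
  assumes "\<And>i. i \<in> I \<Longrightarrow> loewner_le (S i) (T i)"
  shows "loewner_le (\<Sum>i\<in>I. S i) (\<Sum>i\<in>I. T i)"
  using assms
  by (induction I rule: infinite_finite_induct) (auto intro: loewner_le_add simp: loewner_le_refl)

lemma loewner_le_congr: "loewner_le S T \<Longrightarrow> loewner_le (congr G S) (congr G T)"
  unfolding loewner_le_def by (simp add: inner_congr)

text \<open>Diagonal entries are values of the quadratic form at unit vectors, which makes the trace
  monotone in the Loewner order.\<close>

lemma trace_eq_sum_inner_axis: "trace S = (\<Sum>i\<in>UNIV. axis i 1 \<bullet> (S *v axis i 1))"
  by (simp add: trace_def matrix_vector_mult_basis inner_axis' column_def)

lemma trace_mono: "loewner_le S T \<Longrightarrow> trace S \<le> trace T"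
  unfolding loewner_le_def trace_eq_sum_inner_axis by (intro sum_mono) blast

lemma matrix_add_rdistrib: "(S + T) ** W = S ** W + T ** (W :: real^'k^'l)"
  by (simp add: matrix_matrix_mult_def vec_eq_iff sum.distrib distrib_right)

text \<open>Bounded linearity of \<open>congr\<close>, and below of the trace and the quadratic
  forms, allows exchange with integrals, time averages and limits.\<close>

lemma bounded_linear_congr: "bounded_linear (congr S)"
  unfolding linear_conv_bounded_linear[symmetric] congr_def
  by (rule linearI)
    (simp_all add: matrix_add_ldistrib matrix_add_rdistrib matrix_scalar_ac scalar_matrix_assoc[symmetric])

lemma bounded_linear_trace: "bounded_linear (trace :: real^'k^'k \<Rightarrow> real)"
  unfolding linear_conv_bounded_linear[symmetric]
  by (rule linearI) (simp_all add: trace_def sum.distrib sum_distrib_left)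

lemma bounded_linear_quadratic_form: "bounded_linear (\<lambda>S :: real^'k^'k. x \<bullet> (S *v x))"
  unfolding linear_conv_bounded_linear[symmetric]
  by (rule linearI)
     (simp_all add: matrix_vector_mult_add_rdistrib inner_add_right scaleR_matrix_vector_assoc[symmetric])

section \<open>Rank-one matrices\<close>

lemma outer_nth: "outer x y $ a $ b = x $ a * y $ b"
  by (simp add: outer_def)

lemma trace_outer: "trace (outer x x) = x \<bullet> x"
  by (simp add: trace_def outer_nth inner_vec_def)

lemma outer_mult_vec: "outer x y *v z = (y \<bullet> z) *\<^sub>R x"
  by (simp add: vec_eq_iff outer_nth matrix_vector_mult_def inner_vec_def sum_distrib_left
      sum_distrib_right mult_ac)

lemma congr_outer: "congr S (outer x x) = outer (S *v x) (S *v x)"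
proof -
  have "congr S (outer x x) *v z = outer (S *v x) (S *v x) *v z" for z
    by (simp add: congr_def matrix_vector_mul_assoc[symmetric] outer_mult_vec
        matrix_vector_mult_scaleR inner_commute[of x] inner_commute[of "S *v x"] dot_lmul_matrix)
  then show ?thesis by (simp add: matrix_eq)
qed

text \<open>The norm of a matrix is here the Frobenius norm, and the rows of
  \<open>outer x y\<close> are multiples of \<open>y\<close>, so it factors exactly.\<close>

lemma norm_outer: "norm (outer x y) = norm x * norm y"
proof -
  have "outer x y $ i = x $ i *\<^sub>R y" for i
    by (simp add: vec_eq_iff outer_nth)
  then show ?thesis
    by (simp add: norm_vec_def[of "outer x y"] L2_set_left_distrib norm_vec_def[of x])
qed

lemma bounded_bilinear_outer: "bounded_bilinear outer"
proof
  show "\<exists>K. \<forall>a b. norm (outer a b) \<le> norm a * norm b * K"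
    by (rule exI[of _ 1]) (simp add: norm_outer)
qed (simp_all add: vec_eq_iff outer_nth algebra_simps)

text \<open>Resolution of the identity: it collects the contributions of the coordinates of the
  additive noise into the term \<open>I\<close> of the constraint.\<close>

lemma sum_outer_axis: "(\<Sum>b\<in>UNIV. outer (axis b 1) (axis b 1)) = (mat 1 :: real^'n^'n)"
proof -
  have "(\<Sum>b\<in>UNIV. (axis b 1 :: real^'n) $ i * (axis b 1 :: real^'n) $ j) = (if i = j then 1 else 0)"
    for i j :: 'n
  proof -
    have "(\<Sum>b\<in>UNIV. (axis b 1 :: real^'n) $ i * (axis b 1 :: real^'n) $ j)
        = (\<Sum>b\<in>UNIV. if b = i then (if i = j then 1 else 0) else 0)"
      by (rule sum.cong) (auto simp: axis_def)
    then show ?thesis by simp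
  qed
  then show ?thesis
    by (simp add: vec_eq_iff sum_component outer_nth mat_def)
qed

section \<open>Block vectors\<close>

lemma sum_UNIV_Plus:
  fixes f :: "'n::finite + 'm::finite \<Rightarrow> 'c::comm_monoid_add"
  shows "(\<Sum>i\<in>UNIV. f i) = (\<Sum>a\<in>UNIV. f (Inl a)) + (\<Sum>b\<in>UNIV. f (Inr b))"
  unfolding UNIV_Plus_UNIV[symmetric] by (subst sum.Plus) simp_all

lemma hcat_join: "hcat S T *v join x u = S *v x + T *v u"
  by (simp add: vec_eq_iff hcat_def join_def matrix_vector_mult_def sum_UNIV_Plus)

lemma inner_join: "join x u \<bullet> join y v = x \<bullet> y + u \<bullet> v"
  by (simp add: join_def inner_vec_def sum_UNIV_Plus)

lemma vcat_mult_vec: "vcat S T *v x = join (S *v x) (T *v x)"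
  by (simp add: vec_eq_iff vcat_def join_def matrix_vector_mult_def split: sum.splits)

lemma ex_join: "\<exists>x u. z = join x u"
  by (rule exI[of _ "\<chi> a. z $ Inl a"], rule exI[of _ "\<chi> b. z $ Inr b"])
     (auto simp: vec_eq_iff join_def split: sum.splits)

section \<open>Positive definite matrices and the Schur complement\<close>

lemma pos_def_quadratic_bound:
  assumes "pos_def S"
  obtains l where "l > 0" "\<And>x. l * (norm x)\<^sup>2 \<le> x \<bullet> (S *v x)"
proof -
  let ?S = "sphere (0 :: real^'a) 1"
  \<comment> \<open>The constant is the minimum of the form on the compact unit sphere; all other
    nonzero vectors are reduced to the sphere by scaling.\<close>
  have "compact ?S" by simp
  moreover have "?S \<noteq> {}" using vector_choose_size[of 1] by force
  moreover have "continuous_on ?S (\<lambda>x. x \<bullet> (S *v x))"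
    by (intro continuous_intros linear_continuous_on matrix_vector_mul_bounded_linear)
  ultimately have "\<exists>x0\<in>?S. \<forall>y\<in>?S. x0 \<bullet> (S *v x0) \<le> y \<bullet> (S *v y)"
    by (rule continuous_attains_inf)
  then obtain x0 where x0: "x0 \<in> ?S" "\<And>y. y \<in> ?S \<Longrightarrow> x0 \<bullet> (S *v x0) \<le> y \<bullet> (S *v y)"
    by blast
  let ?l = "x0 \<bullet> (S *v x0)"
  have "?l > 0"
  proof -
    have "x0 \<noteq> 0" using x0(1) by auto
    then show ?thesis using assms unfolding pos_def_def by blast
  qed
  moreover have "?l * (norm x)\<^sup>2 \<le> x \<bullet> (S *v x)" for x
  proof (cases "x = 0")
    case False
    define y where "y = (1 / norm x) *\<^sub>R x"
    have "y \<in> ?S" "x = norm x *\<^sub>R y"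
      using False by (simp_all add: y_def)
    then have "x \<bullet> (S *v x) = (norm x *\<^sub>R y) \<bullet> (S *v (norm x *\<^sub>R y))" by simp
    also have "\<dots> = (norm x)\<^sup>2 * (y \<bullet> (S *v y))"
      by (simp only: matrix_vector_mult_scaleR inner_scaleR_left inner_scaleR_right power2_eq_square mult.assoc)
    finally have "x \<bullet> (S *v x) = (norm x)\<^sup>2 * (y \<bullet> (S *v y))" .
    then show ?thesis
      using x0(2)[OF \<open>y \<in> ?S\<close>] by (simp add: mult.commute[of "(norm x)\<^sup>2"] mult_right_mono)
  qed simp
  ultimately show ?thesis using that by blast
qed

text \<open>Positive definiteness makes the square matrix injective, hence invertible.
  \<open>matrix_inv\<close> is a Hilbert choice, so both equations are extracted from
  existence.\<close>

lemma pos_def_matrix_inv: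
  fixes X :: "real^'n^'n"
  assumes "pos_def X"
  shows "X ** matrix_inv X = mat 1" "matrix_inv X ** X = mat 1"
proof -
  have "inj ((*v) X)"
  proof (rule injI)
    fix x y assume "X *v x = X *v y"
    then have "(x - y) \<bullet> (X *v (x - y)) = 0" by (simp add: matrix_vector_mult_diff_distrib)
    then show "x = y" using assms unfolding pos_def_def by (metis eq_iff_diff_eq_0 less_irrefl)
  qed
  then have "invertible X"
    by (simp add: invertible_left_inverse matrix_left_invertible_injective)
  then have "X ** matrix_inv X = mat 1 \<and> matrix_inv X ** X = mat 1"
    unfolding invertible_def matrix_inv_def by (rule someI_ex)
  then show "X ** matrix_inv X = mat 1" "matrix_inv X ** X = mat 1" by simp_all
qed

lemma pos_semidef_block_quadratic:
  "join a b \<bullet> (vcat (hcat X R) (hcat (transpose R) U) *v join a b)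
   = a \<bullet> (X *v a) + 2 * (a \<bullet> (R *v b)) + b \<bullet> (U *v b)"
  by (simp add: vcat_mult_vec hcat_join inner_join inner_add_right inner_commute[of b] dot_lmul_matrix)

text \<open>The left side has the blocks \<open>X\<close> and \<open>R\<close> of the right side,
  with \<open>U\<close> replaced by \<open>R\<^sup>T X\<^sup>-\<^sup>1 R\<close>. At
  \<open>(a, b)\<close> with \<open>c = X\<^sup>-\<^sup>1 R b\<close> its form is that of
  \<open>X\<close> at \<open>a + c\<close>; completing the square, the gap is the Schur complement
  at \<open>b\<close>.\<close>

lemma congr_gain_le:
  fixes X :: "real^'n^'n" and R :: "real^'m^'n" and U :: "real^'m^'m"
  assumes "pos_def X" and V: "pos_semidef (vcat (hcat X R) (hcat (transpose R) U))"
  shows "loewner_le (congr (vcat (mat 1) (transpose R ** matrix_inv X)) X)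
           (vcat (hcat X R) (hcat (transpose R) U))"
  unfolding loewner_le_def
proof
  fix z :: "real^('n + 'm)"
  let ?Xi = "matrix_inv X" and ?V = "vcat (hcat X R) (hcat (transpose R) U)"
  let ?K = "transpose R ** ?Xi"
  obtain a b where z: "z = join a b" using ex_join by blast
  define c where "c = ?Xi *v (R *v b)"
  have Xc: "X *v c = R *v b"
    by (simp add: c_def matrix_vector_mul_assoc matrix_mul_assoc pos_def_matrix_inv[OF assms(1)])
  have sym: "x \<bullet> (X *v y) = (X *v x) \<bullet> y" for x y
  proof -
    have "X *v x = x v* X"
      using assms(1) transpose_matrix_vector[of X x] unfolding pos_def_def by simp
    then show ?thesis by (simp add: dot_lmul_matrix)
  qed
  \<comment> \<open>The transposed gain sends \<open>(a, b)\<close> to \<open>a + c\<close>. This is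
    tested against every \<open>y\<close>, using \<open>R b = X c\<close> and the symmetry of
    \<open>X\<close>.\<close>
  have zG: "z v* vcat (mat 1) ?K = a + c"
  proof -
    have "(z v* vcat (mat 1) ?K) \<bullet> y = (a + c) \<bullet> y" for y
    proof -
      have "(z v* vcat (mat 1) ?K) \<bullet> y = a \<bullet> y + (R *v b) \<bullet> (?Xi *v y)"
        by (simp add: dot_lmul_matrix vcat_mult_vec z inner_join matrix_vector_mul_assoc[symmetric]
            inner_commute[of b])
           (simp add: inner_commute dot_lmul_matrix)
      also have "(R *v b) \<bullet> (?Xi *v y) = c \<bullet> y"
        using sym[of c "?Xi *v y"] Xc
        by (simp add: matrix_vector_mul_assoc pos_def_matrix_inv[OF assms(1)])
      finally show ?thesis by (simp add: inner_add_left)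
    qed
    then show ?thesis by (metis vector_eq_rdot)
  qed
  \<comment> \<open>Schur complement: \<open>V\<close> at \<open>(-X\<^sup>-\<^sup>1 R b, b)\<close> gives \<open>R\<^sup>T X\<^sup>-\<^sup>1 R \<le> U\<close>.\<close>
  have "0 \<le> join (- c) b \<bullet> (?V *v join (- c) b)"
    using V unfolding pos_semidef_def by blast
  then have "c \<bullet> (X *v c) \<le> b \<bullet> (U *v b)"
    unfolding pos_semidef_block_quadratic Xc[symmetric]
    using matrix_vector_mult_diff_distrib[of X 0 c] by simp
  moreover have "(a + c) \<bullet> (X *v (a + c)) = a \<bullet> (X *v a) + 2 * (a \<bullet> (X *v c)) + c \<bullet> (X *v c)"
    using sym[of a c] by (simp add: inner_add_left inner_add_right matrix_vector_right_distrib inner_commute)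
  ultimately show "z \<bullet> (congr (vcat (mat 1) ?K) X *v z) \<le> z \<bullet> (?V *v z)"
    by (simp add: inner_congr zG) (simp add: z pos_semidef_block_quadratic Xc)
qed

subsection \<open>Second moments\<close>

text \<open>Measurability is included because integrability of the squared norm does not imply
  it.\<close>

definition square_integrable :: "'a measure \<Rightarrow> ('a \<Rightarrow> real^'n) \<Rightarrow> bool" where
  "square_integrable P f \<longleftrightarrow> f \<in> borel_measurable P \<and> integrable P (\<lambda>\<omega>. (norm (f \<omega>))\<^sup>2)"

text \<open>An uncentred second moment, taken as a Bochner integral of matrices so that it commutes
  with bounded linear maps.\<close>

definition moment :: "'a measure \<Rightarrow> ('a \<Rightarrow> real^'n) \<Rightarrow> real^'n^'n" where
  "moment P f = (\<integral>\<omega>. outer (f \<omega>) (f \<omega>) \<partial>P)"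

lemma square_integrable_dominated:
  assumes f: "f \<in> borel_measurable P" and g: "integrable P g"
    and le: "\<And>\<omega>. (norm (f \<omega>))\<^sup>2 \<le> g \<omega>"
  shows "square_integrable P f"
  unfolding square_integrable_def
proof
  show "integrable P (\<lambda>\<omega>. (norm (f \<omega>))\<^sup>2)"
  proof (rule Bochner_Integration.integrable_bound[OF g])
    show "AE \<omega> in P. norm ((norm (f \<omega>))\<^sup>2) \<le> norm (g \<omega>)"
      using order_trans[OF le abs_ge_self] by simp
  qed (use f in measurable)
qed fact

lemma square_integrable_add:
  assumes "square_integrable P f" "square_integrable P g"
  shows "square_integrable P (\<lambda>\<omega>. f \<omega> + g \<omega>)"
proof (rule square_integrable_dominated)
  show "integrable P (\<lambda>\<omega>. 2 * (norm (f \<omega>))\<^sup>2 + 2 * (norm (g \<omega>))\<^sup>2)"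
    using assms unfolding square_integrable_def by auto
  show "(norm (f \<omega> + g \<omega>))\<^sup>2 \<le> 2 * (norm (f \<omega>))\<^sup>2 + 2 * (norm (g \<omega>))\<^sup>2" for \<omega>
  proof -
    \<comment> \<open>By the parallelogram law this square is exactly the gap in the claim.\<close>
    have "0 \<le> (norm (f \<omega> - g \<omega>))\<^sup>2" by simp
    then show ?thesis
      by (simp add: power2_norm_eq_inner inner_add_left inner_add_right inner_diff_left inner_diff_right
          inner_commute)
  qed
qed (use assms in \<open>auto simp: square_integrable_def\<close>)

lemma square_integrable_sum:
  assumes "\<And>i. i \<in> I \<Longrightarrow> square_integrable P (f i)"
  shows "square_integrable P (\<lambda>\<omega>. \<Sum>i\<in>I. f i \<omega>)"
  using assms
proof (induction I rule: infinite_finite_induct)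
  case (insert i I)
  then show ?case by (simp add: square_integrable_add)
qed (simp_all add: square_integrable_def)

lemma matrix_vector_measurable:
  fixes S :: "real^'k^'l"
  assumes "f \<in> borel_measurable N" shows "(\<lambda>\<omega>. S *v f \<omega>) \<in> borel_measurable N"
  by (rule borel_measurable_continuous_on[OF _ assms])
     (intro linear_continuous_on matrix_vector_mul_bounded_linear)

lemma square_integrable_matrix_vector:
  assumes "square_integrable P f"
  shows "square_integrable P (\<lambda>\<omega>. S *v f \<omega>)"
proof (rule square_integrable_dominated)
  show "(\<lambda>\<omega>. S *v f \<omega>) \<in> borel_measurable P"
    using assms by (simp add: square_integrable_def matrix_vector_measurable)
  show "integrable P (\<lambda>\<omega>. (onorm ((*v) S))\<^sup>2 * (norm (f \<omega>))\<^sup>2)"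
    using assms by (simp add: square_integrable_def)
  show "(norm (S *v f \<omega>))\<^sup>2 \<le> (onorm ((*v) S))\<^sup>2 * (norm (f \<omega>))\<^sup>2" for \<omega>
    using onorm[OF matrix_vector_mul_bounded_linear, of S "f \<omega>"]
    by (metis norm_ge_zero power_mono power_mult_distrib)
qed

lemma borel_measurable_outer:
  assumes "f \<in> borel_measurable P" "g \<in> borel_measurable P"
  shows "(\<lambda>\<omega>. outer (f \<omega>) (g \<omega>)) \<in> borel_measurable P"
  by (rule borel_measurable_continuous_Pair[OF assms])
     (intro bounded_bilinear.continuous_on[OF bounded_bilinear_outer] continuous_intros)

lemma integrable_outer:
  assumes "square_integrable P f" "square_integrable P g"
  shows "integrable P (\<lambda>\<omega>. outer (f \<omega>) (g \<omega>))"
proof (rule Bochner_Integration.integrable_bound)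
  show "integrable P (\<lambda>\<omega>. (norm (f \<omega>))\<^sup>2 + (norm (g \<omega>))\<^sup>2)"
    using assms by (simp add: square_integrable_def)
  show "(\<lambda>\<omega>. outer (f \<omega>) (g \<omega>)) \<in> borel_measurable P"
    using assms by (simp add: square_integrable_def borel_measurable_outer)
  show "AE \<omega> in P. norm (outer (f \<omega>) (g \<omega>)) \<le> norm ((norm (f \<omega>))\<^sup>2 + (norm (g \<omega>))\<^sup>2)"
  proof (rule AE_I2)
    fix \<omega>
    have "2 * (norm (f \<omega>) * norm (g \<omega>)) \<le> (norm (f \<omega>))\<^sup>2 + (norm (g \<omega>))\<^sup>2"
      using sum_squares_bound[of "norm (f \<omega>)" "norm (g \<omega>)"] by simp
    moreover have "0 \<le> norm (f \<omega>) * norm (g \<omega>)" by simp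
    ultimately have "norm (f \<omega>) * norm (g \<omega>) \<le> (norm (f \<omega>))\<^sup>2 + (norm (g \<omega>))\<^sup>2"
      by linarith
    then show "norm (outer (f \<omega>) (g \<omega>)) \<le> norm ((norm (f \<omega>))\<^sup>2 + (norm (g \<omega>))\<^sup>2)"
      by (simp add: norm_outer)
  qed
qed

lemma bounded_linear_entry: "bounded_linear (\<lambda>S :: real^'n^'m. S $ a $ b)"
  using bounded_linear_compose[OF bounded_linear_vec_nth[of b] bounded_linear_vec_nth[of a]] by simp

lemma integrable_component_mult:
  assumes "square_integrable P f" "square_integrable P g"
  shows "integrable P (\<lambda>\<omega>. f \<omega> $ a * g \<omega> $ b)"
  using integrable_bounded_linear[OF bounded_linear_entry integrable_outer[OF assms], of a b]
  by (simp add: outer_nth)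

lemma moment_nth:
  assumes "square_integrable P f"
  shows "moment P f $ a $ b = (\<integral>\<omega>. f \<omega> $ a * f \<omega> $ b \<partial>P)"
  using integral_bounded_linear[OF bounded_linear_entry integrable_outer[OF assms assms], of a b]
  by (simp add: moment_def outer_nth)

lemma congr_moment:
  assumes "square_integrable P f"
  shows "congr S (moment P f) = moment P (\<lambda>\<omega>. S *v f \<omega>)"
  using integral_bounded_linear[OF bounded_linear_congr integrable_outer[OF assms assms], of S]
  by (simp add: moment_def congr_outer)

lemma trace_moment:
  assumes "square_integrable P f"
  shows "trace (moment P f) = (\<integral>\<omega>. f \<omega> \<bullet> f \<omega> \<partial>P)"
  using integral_bounded_linear[OF bounded_linear_trace integrable_outer[OF assms assms]]
  by (simp add: moment_def trace_outer)

text \<open>The norm of \<open>outer x x\<close> is the squared norm of \<open>x\<close>. This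
  bounds both the averaged moments and the boundary term of the telescoping sum.\<close>

lemma norm_moment_le: "norm (moment P f) \<le> (\<integral>\<omega>. f \<omega> \<bullet> f \<omega> \<partial>P)"
  unfolding moment_def
  using integral_norm_bound[of P "\<lambda>\<omega>. outer (f \<omega>) (f \<omega>)"]
  by (simp add: norm_outer power2_norm_eq_inner[symmetric] power2_eq_square)

text \<open>The quadratic form at \<open>x\<close> is the integral of the square of
  \<open>f \<omega> \<bullet> x\<close>.\<close>

lemma pos_semidef_moment:
  assumes "square_integrable P f"
  shows "pos_semidef (moment P f)"
  unfolding pos_semidef_def
proof (intro conjI allI)
  show "transpose (moment P f) = moment P f"
    by (simp add: vec_eq_iff transpose_def moment_nth[OF assms] mult.commute)
  fix x
  from integral_bounded_linear[OF bounded_linear_quadratic_form integrable_outer[OF assms assms]]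
  have "x \<bullet> (moment P f *v x) = (\<integral>\<omega>. (f \<omega> \<bullet> x)\<^sup>2 \<partial>P)"
    by (simp add: moment_def outer_mult_vec inner_commute power2_eq_square)
  then show "0 \<le> x \<bullet> (moment P f *v x)" by simp
qed

lemma square_integrable_join:
  assumes "square_integrable P f" "square_integrable P g"
  shows "square_integrable P (\<lambda>\<omega>. join (f \<omega>) (g \<omega>))"
proof -
  have "join (f \<omega>) (g \<omega>) = vcat (mat 1) 0 *v f \<omega> + vcat 0 (mat 1) *v g \<omega>" for \<omega>
    by (simp add: vec_eq_iff vcat_mult_vec join_def split: sum.splits)
  then show ?thesis
    using assms by (simp add: square_integrable_add square_integrable_matrix_vector)
qed

subsection \<open>Independent noise\<close>

text \<open>Intersection stability lets independence pass from the single noises to the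
  sigma-algebras generated by groups of them.\<close>

lemma Int_stable_vimage: "Int_stable {f -` S \<inter> X | S. S \<in> sets N}"
proof (rule Int_stableI)
  fix a b
  assume "a \<in> {f -` S \<inter> X | S. S \<in> sets N}" "b \<in> {f -` S \<inter> X | S. S \<in> sets N}"
  then obtain S T where "S \<in> sets N" "T \<in> sets N" "a = f -` S \<inter> X" "b = f -` T \<inter> X"
    by blast
  then have "a \<inter> b = f -` (S \<inter> T) \<inter> X" "S \<inter> T \<in> sets N"
    by auto
  then show "a \<inter> b \<in> {f -` S \<inter> X | S. S \<in> sets N}" by blast
qed

lemma borel_measurable_vec_nth:
  fixes f :: "'a \<Rightarrow> real^'k"
  assumes "f \<in> borel_measurable N" shows "(\<lambda>\<omega>. f \<omega> $ b) \<in> borel_measurable N"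
  by (rule borel_measurable_continuous_on[OF _ assms]) (intro continuous_intros)

locale noise = prob_space P for P :: "'a measure" +
  fixes M :: nat
    and w :: "nat \<Rightarrow> 'a \<Rightarrow> real^'n"
    and \<sigma> :: "nat \<Rightarrow> nat \<Rightarrow> 'a \<Rightarrow> real"
  assumes w_measurable: "\<And>k. w k \<in> borel_measurable P"
    and w_square: "\<And>k. integrable P (\<lambda>\<omega>. (norm (w k \<omega>))\<^sup>2)"
    and w_mean: "\<And>k. (\<integral>\<omega>. w k \<omega> \<partial>P) = 0"
    and w_cov: "\<And>k. (\<integral>\<omega>. outer (w k \<omega>) (w k \<omega>) \<partial>P) = mat 1"
    and \<sigma>_measurable: "\<And>k i. i \<in> {1..M} \<Longrightarrow> \<sigma> k i \<in> borel_measurable P"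
    and \<sigma>_square: "\<And>k i. i \<in> {1..M} \<Longrightarrow> integrable P (\<lambda>\<omega>. (\<sigma> k i \<omega>)\<^sup>2)"
    and \<sigma>_mean: "\<And>k i. i \<in> {1..M} \<Longrightarrow> (\<integral>\<omega>. \<sigma> k i \<omega> \<partial>P) = 0"
    and \<sigma>_var: "\<And>k i. i \<in> {1..M} \<Longrightarrow> (\<integral>\<omega>. (\<sigma> k i \<omega>)\<^sup>2 \<partial>P) = 1"
    and independent: "independent_noise P M w \<sigma>"
begin

definition gen :: "nat + nat \<times> nat \<Rightarrow> 'a set set" where
  "gen = case_sum (\<lambda>k. {w k -` S \<inter> space P | S. S \<in> sets borel})
           (\<lambda>(k, i). {\<sigma> k i -` S \<inter> space P | S. S \<in> sets borel})"

definition indices :: "(nat + nat \<times> nat) set" where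
  "indices = UNIV <+> (UNIV \<times> {1..M})"

definition noise_algebra :: "(nat + nat \<times> nat) set \<Rightarrow> 'a measure" where
  "noise_algebra I = sigma (space P) (\<Union>i\<in>I. gen i)"

lemma indep_gen: "indep_sets gen indices"
  using independent by (simp add: independent_noise_def gen_def indices_def)

lemma Int_stable_gen: "Int_stable (gen i)"
  by (cases i) (auto simp: gen_def Int_stable_vimage)

lemma gen_subset_Pow: "(\<Union>i\<in>I. gen i) \<subseteq> Pow (space P)"
  by (auto simp: gen_def split: sum.splits)

lemma space_noise_algebra [simp]: "space (noise_algebra I) = space P"
  unfolding noise_algebra_def by (rule space_measure_of[OF gen_subset_Pow])

lemma sets_noise_algebra: "sets (noise_algebra I) = sigma_sets (space P) (\<Union>i\<in>I. gen i)"
  unfolding noise_algebra_def by (rule sets_measure_of[OF gen_subset_Pow])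

lemma noise_algebra_measurable_mono:
  assumes "I \<subseteq> J" "f \<in> measurable (noise_algebra I) N"
  shows "f \<in> measurable (noise_algebra J) N"
proof (rule measurableI)
  have "sets (noise_algebra I) \<subseteq> sets (noise_algebra J)"
    unfolding sets_noise_algebra by (rule sigma_sets_mono') (use assms(1) in blast)
  then show "f -` S \<inter> space (noise_algebra J) \<in> sets (noise_algebra J)" if "S \<in> sets N" for S
    using measurable_sets[OF assms(2) that] by auto
qed (use measurable_space[OF assms(2)] in simp)

lemma noise_algebra_measurable:
  assumes "I \<subseteq> indices" "f \<in> measurable (noise_algebra I) N"
  shows "f \<in> measurable P N"
proof (rule measurableI)
  have "(\<Union>i\<in>I. gen i) \<subseteq> sets P"
    using indep_gen assms(1) unfolding indep_sets_def by blast
  then have "sets (noise_algebra I) \<subseteq> sets P"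
    unfolding sets_noise_algebra by (rule sets.sigma_sets_subset)
  then show "f -` S \<inter> space P \<in> sets P" if "S \<in> sets N" for S
    using measurable_sets[OF assms(2) that] by auto
qed (use measurable_space[OF assms(2)] in simp)

lemma w_noise_measurable:
  assumes "Inl k \<in> I"
  shows "w k \<in> borel_measurable (noise_algebra I)"
proof (rule measurableI)
  fix S :: "(real^'n) set" assume "S \<in> sets borel"
  then have "w k -` S \<inter> space P \<in> gen (Inl k)" by (auto simp: gen_def)
  then show "w k -` S \<inter> space (noise_algebra I) \<in> sets (noise_algebra I)"
    using assms unfolding sets_noise_algebra space_noise_algebra by (blast intro: sigma_sets.Basic)
qed simp

lemma \<sigma>_noise_measurable:
  assumes "Inr (k, i) \<in> I"
  shows "\<sigma> k i \<in> borel_measurable (noise_algebra I)"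
proof (rule measurableI)
  fix S :: "real set" assume "S \<in> sets borel"
  then have "\<sigma> k i -` S \<inter> space P \<in> gen (Inr (k, i))" by (auto simp: gen_def)
  then show "\<sigma> k i -` S \<inter> space (noise_algebra I) \<in> sets (noise_algebra I)"
    using assms unfolding sets_noise_algebra space_noise_algebra by (blast intro: sigma_sets.Basic)
qed simp

text \<open>Disjoint groups of noises generate independent sigma-algebras, so expectations factor.
  Independence also supplies the integrability of the product, without any pointwise bound.\<close>

lemma noise_algebra_indep_mult:
  fixes p q :: "'a \<Rightarrow> real"
  assumes IJ: "I \<subseteq> indices" "J \<subseteq> indices" "I \<inter> J = {}"
    and p: "p \<in> borel_measurable (noise_algebra I)" "integrable P p"
    and q: "q \<in> borel_measurable (noise_algebra J)" "integrable P q"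
  shows "integrable P (\<lambda>\<omega>. p \<omega> * q \<omega>)"
    and "(\<integral>\<omega>. p \<omega> * q \<omega> \<partial>P) = (\<integral>\<omega>. p \<omega> \<partial>P) * (\<integral>\<omega>. q \<omega> \<partial>P)"
proof -
  \<comment> \<open>The two groups are indexed by booleans so that the grouping theorem for
    independent families applies.\<close>
  have "indep_sets (\<lambda>b. sigma_sets (space P) (\<Union>i\<in>case_bool I J b. gen i)) UNIV"
  proof (rule indep_sets_collect_sigma)
    show "indep_sets gen (\<Union>b\<in>UNIV. case_bool I J b)"
      using IJ by (intro indep_sets_mono_index[OF _ indep_gen]) (auto split: bool.splits)
    show "disjoint_family_on (case_bool I J) UNIV"
      using IJ(3) by (auto simp: disjoint_family_on_def split: bool.splits)
  qed (rule Int_stable_gen)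
  then have indep: "indep_set (sets (noise_algebra I)) (sets (noise_algebra J))"
    unfolding indep_set_def
    by (rule indep_sets_mono_sets) (simp add: sets_noise_algebra split: bool.splits)
  \<comment> \<open>A function measurable for a noise algebra generates a smaller sigma-algebra,
    which inherits the independence.\<close>
  have sub: "sigma_sets (space P) {f -` S \<inter> space P | S. S \<in> sets borel} \<subseteq> sets (noise_algebra K)"
    if "f \<in> borel_measurable (noise_algebra K)" for f :: "'a \<Rightarrow> real" and K
    using sets.sigma_sets_subset[of "{f -` S \<inter> space P | S. S \<in> sets borel}" "noise_algebra K"]
      measurable_sets[OF that] by auto
  have "indep_set (sigma_sets (space P) {p -` S \<inter> space P | S. S \<in> sets borel})
          (sigma_sets (space P) {q -` S \<inter> space P | S. S \<in> sets borel})"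
    using indep unfolding indep_set_def
    by (rule indep_sets_mono_sets) (use sub[OF p(1)] sub[OF q(1)] in \<open>simp split: bool.splits\<close>)
  then have "indep_var borel p borel q"
    unfolding indep_var_eq using p(2) q(2) by auto
  then show "integrable P (\<lambda>\<omega>. p \<omega> * q \<omega>)"
    and "(\<integral>\<omega>. p \<omega> * q \<omega> \<partial>P) = (\<integral>\<omega>. p \<omega> \<partial>P) * (\<integral>\<omega>. q \<omega> \<partial>P)"
    using indep_var_integrable indep_var_lebesgue_integral p(2) q(2) by blast+
qed

text \<open>The bound is strict: under a measurable policy the state and the input at time
  \<open>k\<close> depend only on noise before \<open>k\<close>, hence are independent of
  \<open>present k\<close>.\<close>

definition past :: "nat \<Rightarrow> (nat + nat \<times> nat) set" where
  "past k = {..<k} <+> ({..<k} \<times> {1..M})"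

definition present :: "nat \<Rightarrow> (nat + nat \<times> nat) set" where
  "present k = {k} <+> ({k} \<times> {1..M})"

lemma past_present:
  "past k \<subseteq> indices" "present k \<subseteq> indices" "past k \<inter> present k = {}"
  "j \<le> k \<Longrightarrow> past j \<subseteq> past k" "present k \<subseteq> past (Suc k)"
  by (auto simp: past_def present_def indices_def)

text \<open>The state is driven by the orthonormal family consisting of the constant \<open>1\<close>,
  the \<open>\<sigma>\<^sub>k(i)\<close> and the coordinates of \<open>w\<^sub>k\<close>.\<close>

definition slots :: "(nat + 'n) option set" where
  "slots = insert None (Some ` ({1..M} <+> UNIV))"

definition scalar_noise :: "nat \<Rightarrow> (nat + 'n) option \<Rightarrow> 'a \<Rightarrow> real" where
  "scalar_noise k s \<omega> =
     (case s of None \<Rightarrow> 1 | Some (Inl i) \<Rightarrow> \<sigma> k i \<omega> | Some (Inr b) \<Rightarrow> w k \<omega> $ b)"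

lemma sum_slots:
  fixes f :: "(nat + 'n) option \<Rightarrow> 'c::comm_monoid_add"
  shows "(\<Sum>s\<in>slots. f s)
    = f None + ((\<Sum>i=1..M. f (Some (Inl i))) + (\<Sum>b\<in>UNIV. f (Some (Inr b))))"
  unfolding slots_def by (subst sum.insert) (auto simp: sum.reindex sum.Plus)

lemma finite_slots: "finite slots"
  by (simp add: slots_def)

lemma slots_cases:
  assumes "s \<in> slots"
  obtains "s = None" | i where "s = Some (Inl i)" "i \<in> {1..M}" | b where "s = Some (Inr b)"
  using assms by (auto simp: slots_def)

lemma scalar_noise_measurable:
  assumes "s \<in> slots"
  shows "scalar_noise k s \<in> borel_measurable (noise_algebra (present k))"
  using assms
proof (cases rule: slots_cases)
  case (2 i)
  then have "scalar_noise k s = \<sigma> k i" by (simp add: scalar_noise_def fun_eq_iff)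
  moreover have "Inr (k, i) \<in> present k" using 2 by (auto simp: present_def)
  ultimately show ?thesis by (simp add: \<sigma>_noise_measurable)
next
  case (3 b)
  have "w k \<in> borel_measurable (noise_algebra (present k))"
    by (rule w_noise_measurable) (auto simp: present_def)
  with 3 show ?thesis by (simp add: scalar_noise_def[abs_def] borel_measurable_vec_nth)
qed (simp add: scalar_noise_def[abs_def])

lemma w_square_integrable: "square_integrable P (w k)"
  by (simp add: square_integrable_def w_measurable w_square)

lemma scalar_noise_measurable':
  assumes "s \<in> slots" shows "scalar_noise k s \<in> borel_measurable P"
  using noise_algebra_measurable[OF past_present(2) scalar_noise_measurable[OF assms]] .

lemma scalar_noise_square_integrable:
  assumes "s \<in> slots"
  shows "integrable P (\<lambda>\<omega>. (scalar_noise k s \<omega>)\<^sup>2)"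
  using assms
proof (cases rule: slots_cases)
  case (2 i)
  then show ?thesis by (simp add: scalar_noise_def \<sigma>_square)
next
  case (3 b)
  then show ?thesis
    using integrable_component_mult[OF w_square_integrable w_square_integrable, of k b k b]
    by (simp add: scalar_noise_def power2_eq_square)
qed (simp add: scalar_noise_def)

lemma scalar_noise_mult_integrable:
  assumes "s \<in> slots" "t \<in> slots"
  shows "integrable P (\<lambda>\<omega>. scalar_noise k s \<omega> * scalar_noise k t \<omega>)"
proof (rule Bochner_Integration.integrable_bound)
  note [measurable] = scalar_noise_measurable'[OF assms(1)] scalar_noise_measurable'[OF assms(2)]
  show "integrable P (\<lambda>\<omega>. (scalar_noise k s \<omega>)\<^sup>2 + (scalar_noise k t \<omega>)\<^sup>2)"
    by (intro Bochner_Integration.integrable_add scalar_noise_square_integrable assms)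
  show "AE \<omega> in P. norm (scalar_noise k s \<omega> * scalar_noise k t \<omega>)
      \<le> norm ((scalar_noise k s \<omega>)\<^sup>2 + (scalar_noise k t \<omega>)\<^sup>2)"
  proof (rule AE_I2)
    fix \<omega>
    have "2 * (\<bar>scalar_noise k s \<omega>\<bar> * \<bar>scalar_noise k t \<omega>\<bar>)
        \<le> (scalar_noise k s \<omega>)\<^sup>2 + (scalar_noise k t \<omega>)\<^sup>2"
      using sum_squares_bound[of "\<bar>scalar_noise k s \<omega>\<bar>" "\<bar>scalar_noise k t \<omega>\<bar>"] by simp
    moreover have "0 \<le> \<bar>scalar_noise k s \<omega>\<bar> * \<bar>scalar_noise k t \<omega>\<bar>" by simp
    ultimately have "\<bar>scalar_noise k s \<omega>\<bar> * \<bar>scalar_noise k t \<omega>\<bar>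
        \<le> (scalar_noise k s \<omega>)\<^sup>2 + (scalar_noise k t \<omega>)\<^sup>2"
      by linarith
    then show "norm (scalar_noise k s \<omega> * scalar_noise k t \<omega>)
      \<le> norm ((scalar_noise k s \<omega>)\<^sup>2 + (scalar_noise k t \<omega>)\<^sup>2)"
      by (simp add: abs_mult)
  qed
qed (intro borel_measurable_times scalar_noise_measurable' assms)

text \<open>The slot \<open>None\<close> carries the constant 1, so this is a case of the
  product.\<close>

lemma scalar_noise_integrable: "s \<in> slots \<Longrightarrow> integrable P (scalar_noise k s)"
  using scalar_noise_mult_integrable[of s None k]
  by (simp add: scalar_noise_def[of _ None] slots_def)

lemma scalar_noise_mean:
  assumes "s \<in> slots" "s \<noteq> None"
  shows "(\<integral>\<omega>. scalar_noise k s \<omega> \<partial>P) = 0"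
  using assms(1)
proof (cases rule: slots_cases)
  case (2 i)
  then show ?thesis by (simp add: scalar_noise_def \<sigma>_mean)
next
  case (3 b)
  \<comment> \<open>The zero mean does not give integrability, since a non-integrable function has
    integral 0 by convention; the second moment does.\<close>
  have "integrable P (w k)"
  proof (rule Bochner_Integration.integrable_bound)
    show "integrable P (\<lambda>\<omega>. 1 + (norm (w k \<omega>))\<^sup>2)"
      using w_square by simp
    show "AE \<omega> in P. norm (w k \<omega>) \<le> norm (1 + (norm (w k \<omega>))\<^sup>2)"
    proof (rule AE_I2)
      fix \<omega>
      have "2 * norm (w k \<omega>) \<le> 1 + (norm (w k \<omega>))\<^sup>2"
        using sum_squares_bound[of 1 "norm (w k \<omega>)"] by simp
      then have "norm (w k \<omega>) \<le> 1 + (norm (w k \<omega>))\<^sup>2"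
        using norm_ge_zero[of "w k \<omega>"] by linarith
      then show "norm (w k \<omega>) \<le> norm (1 + (norm (w k \<omega>))\<^sup>2)" by simp
    qed
  qed (rule w_measurable)
  from integral_bounded_linear[OF bounded_linear_vec_nth this, of b]
  have "(\<integral>\<omega>. w k \<omega> $ b \<partial>P) = 0" by (simp add: w_mean)
  with 3 show ?thesis by (simp add: scalar_noise_def)
qed (use assms in simp)

text \<open>Different noises are independent with mean zero. Two coordinates of the same
  \<open>w k\<close> may be dependent, but the identity covariance makes them uncorrelated.\<close>

lemma scalar_noise_orthonormal:
  assumes "s \<in> slots" "t \<in> slots"
  shows "(\<integral>\<omega>. scalar_noise k s \<omega> * scalar_noise k t \<omega> \<partial>P) = (if s = t then 1 else 0)"
proof -
  have indep0: "(\<integral>\<omega>. scalar_noise k s \<omega> * scalar_noise k t \<omega> \<partial>P) = 0"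
    if "s \<in> slots" "t \<in> slots" "s \<noteq> None" "I \<subseteq> indices" "J \<subseteq> indices" "I \<inter> J = {}"
      "scalar_noise k s \<in> borel_measurable (noise_algebra I)"
      "scalar_noise k t \<in> borel_measurable (noise_algebra J)" for s t I J
    using that noise_algebra_indep_mult(2)[of I J "scalar_noise k s" "scalar_noise k t"]
    by (simp add: scalar_noise_integrable scalar_noise_mean)
  have \<sigma>: "scalar_noise k (Some (Inl i)) \<in> borel_measurable (noise_algebra {Inr (k, i)})" for i
    by (simp add: scalar_noise_def[abs_def] \<sigma>_noise_measurable)
  have w: "scalar_noise k (Some (Inr b)) \<in> borel_measurable (noise_algebra {Inl k})" for b
    using borel_measurable_vec_nth[OF w_noise_measurable[of k "{Inl k}"]]
    by (simp add: scalar_noise_def[abs_def])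
  have S: "Some (Inl i) \<in> slots" if "i \<in> {1..M}" for i using that by (auto simp: slots_def)
  have W: "Some (Inr b) \<in> slots" for b by (auto simp: slots_def)
  have mixed: "(\<integral>\<omega>. scalar_noise k (Some (Inl i)) \<omega> * scalar_noise k (Some (Inr b)) \<omega> \<partial>P) = 0"
    if "i \<in> {1..M}" for i b
    by (rule indep0[OF S[OF that] W _ _ _ _ \<sigma> w]) (use that in \<open>auto simp: indices_def\<close>)
  show ?thesis
  proof (cases "s = None \<or> t = None")
    case True
    then show ?thesis
      using scalar_noise_mean[OF assms(1)] scalar_noise_mean[OF assms(2)]
      by (cases s; cases t) (simp_all add: scalar_noise_def[of _ None] prob_space)
  next
    case False
    show ?thesis
      using assms(1)
    proof (cases rule: slots_cases)
      case s: (2 i)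
      show ?thesis
        using assms(2)
      proof (cases rule: slots_cases)
        case t: (2 j)
        show ?thesis
        proof (cases "i = j")
          case True
          then show ?thesis using s t \<sigma>_var[of i k]
            by (simp add: scalar_noise_def power2_eq_square)
        next
          case False
          then have "(\<integral>\<omega>. scalar_noise k (Some (Inl i)) \<omega> * scalar_noise k (Some (Inl j)) \<omega> \<partial>P) = 0"
            by (intro indep0[OF S[OF s(2)] S[OF t(2)] _ _ _ _ \<sigma> \<sigma>])
               (use s t in \<open>auto simp: indices_def\<close>)
          then show ?thesis using s t False by simp
        qed
      next
        case (3 b)
        then show ?thesis using s mixed by simp
      qed (use False in simp)
    next
      case s: (3 b)
      show ?thesis
        using assms(2)
      proof (cases rule: slots_cases)
        case (2 i)
        then show ?thesis using s mixed[of i b] by (simp add: mult.commute)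
      next
        case t: (3 c)
        have "(\<integral>\<omega>. w k \<omega> $ b * w k \<omega> $ c \<partial>P) = (mat 1 :: real^'n^'n) $ b $ c"
          using moment_nth[OF w_square_integrable, of k b c] w_cov[of k] by (simp add: moment_def)
        then show ?thesis using s t by (simp add: scalar_noise_def mat_def)
      qed (use False in simp)
    qed (use False in simp)
  qed
qed

text \<open>A Pythagorean identity for sums over orthonormal noises whose coefficients depend on the
  past: independence splits each cross term into \<open>E[q\<^sub>s q\<^sub>t]\<close> times the
  mixed moment of the coefficients, and orthonormality leaves the diagonal.\<close>

lemma moment_noise_sum:
  fixes h :: "(nat + 'n) option \<Rightarrow> 'a \<Rightarrow> real^'l"
  assumes h: "\<And>s. s \<in> slots \<Longrightarrow> h s \<in> borel_measurable (noise_algebra (past k))"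
    and h2: "\<And>s. s \<in> slots \<Longrightarrow> square_integrable P (h s)"
  shows "square_integrable P (\<lambda>\<omega>. \<Sum>s\<in>slots. scalar_noise k s \<omega> *\<^sub>R h s \<omega>)" (is "square_integrable P ?f")
    and "moment P (\<lambda>\<omega>. \<Sum>s\<in>slots. scalar_noise k s \<omega> *\<^sub>R h s \<omega>) = (\<Sum>s\<in>slots. moment P (h s))"
proof -
  note indep = noise_algebra_indep_mult[OF past_present(2,1)]
  have disj: "present k \<inter> past k = {}" using past_present(3) by blast
  show f: "square_integrable P ?f"
  proof (rule square_integrable_sum)
    fix s assume s: "s \<in> slots"
    note [measurable] = scalar_noise_measurable'[OF s, of k] scalar_noise_measurable[OF s, of k] h[OF s]
    have "h s \<in> borel_measurable P" using h2[OF s] by (simp add: square_integrable_def)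
    note [measurable] = this
    \<comment> \<open>A product of square-integrable functions need not be square-integrable; the
      independence of the squares is what helps.\<close>
    have "integrable P (\<lambda>\<omega>. (scalar_noise k s \<omega>)\<^sup>2 * (norm (h s \<omega>))\<^sup>2)"
      by (rule indep(1)[OF disj])
         (use h2[OF s] scalar_noise_square_integrable[OF s] in \<open>simp_all add: square_integrable_def\<close>)
    then show "square_integrable P (\<lambda>\<omega>. scalar_noise k s \<omega> *\<^sub>R h s \<omega>)"
      by (simp add: square_integrable_def power_mult_distrib)
  qed
  show "moment P ?f = (\<Sum>s\<in>slots. moment P (h s))"
  proof -
    have "moment P ?f $ a $ b = (\<Sum>s\<in>slots. moment P (h s)) $ a $ b" for a b
    proof -
      let ?Q = "\<lambda>s t \<omega>. scalar_noise k s \<omega> * scalar_noise k t \<omega>"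
      let ?H = "\<lambda>s t \<omega>. h s \<omega> $ a * h t \<omega> $ b"
      have QH: "integrable P (\<lambda>\<omega>. ?Q s t \<omega> * ?H s t \<omega>)"
        "(\<integral>\<omega>. ?Q s t \<omega> * ?H s t \<omega> \<partial>P) = (if s = t then \<integral>\<omega>. ?H s s \<omega> \<partial>P else 0)"
        if st: "s \<in> slots" "t \<in> slots" for s t
      proof -
        note [measurable] = scalar_noise_measurable[OF st(1), of k] scalar_noise_measurable[OF st(2), of k]
          borel_measurable_vec_nth[OF h[OF st(1)], of a] borel_measurable_vec_nth[OF h[OF st(2)], of b]
        have Q: "?Q s t \<in> borel_measurable (noise_algebra (present k))"
          and H: "?H s t \<in> borel_measurable (noise_algebra (past k))" by measurable
        note ind = indep[OF disj Q scalar_noise_mult_integrable[OF st] H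
            integrable_component_mult[OF h2[OF st(1)] h2[OF st(2)]]]
        show "integrable P (\<lambda>\<omega>. ?Q s t \<omega> * ?H s t \<omega>)" by (rule ind(1))
        show "(\<integral>\<omega>. ?Q s t \<omega> * ?H s t \<omega> \<partial>P) = (if s = t then \<integral>\<omega>. ?H s s \<omega> \<partial>P else 0)"
          by (simp add: ind(2) scalar_noise_orthonormal[OF st])
      qed
      have "moment P ?f $ a $ b = (\<integral>\<omega>. ?f \<omega> $ a * ?f \<omega> $ b \<partial>P)" by (rule moment_nth[OF f])
      also have "\<dots> = (\<integral>\<omega>. (\<Sum>s\<in>slots. \<Sum>t\<in>slots. ?Q s t \<omega> * ?H s t \<omega>) \<partial>P)"
        by (simp add: sum_product mult_ac)
      also have "\<dots> = (\<Sum>s\<in>slots. \<Sum>t\<in>slots. \<integral>\<omega>. ?Q s t \<omega> * ?H s t \<omega> \<partial>P)"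
        using QH(1) by (simp add: Bochner_Integration.integral_sum)
      also have "\<dots> = (\<Sum>s\<in>slots. \<Sum>t\<in>slots. if s = t then \<integral>\<omega>. ?H s s \<omega> \<partial>P else 0)"
        by (intro sum.cong refl QH(2))
      also have "\<dots> = (\<Sum>s\<in>slots. \<integral>\<omega>. ?H s s \<omega> \<partial>P)"
        by (simp add: finite_slots)
      also have "\<dots> = (\<Sum>s\<in>slots. moment P (h s)) $ a $ b"
        by (simp add: moment_nth[OF h2])
      finally show ?thesis .
    qed
    then show ?thesis by (simp add: vec_eq_iff)
  qed
qed

end

subsection \<open>Moments of the controlled system\<close>

lemma vec_mult_hcat: "a v* hcat S T = join (a v* S) (a v* T)"
  by (simp add: vec_eq_iff vector_matrix_mult_def hcat_def join_def split: sum.splits)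

lemma congr_projection_block:
  "congr (hcat (mat 1) 0) (vcat (hcat X R) (hcat W U)) = X"
proof -
  have "x \<bullet> (congr (hcat (mat 1) 0) (vcat (hcat X R) (hcat W U)) *v y) = x \<bullet> (X *v y)" for x y
    by (simp add: inner_congr vec_mult_hcat vcat_mult_vec hcat_join inner_join)
  then show ?thesis by (metis matrix_eq vector_eq_ldot)
qed

lemma sdp_objective_eq: "sdp_objective C D V = trace (congr (hcat C D) V)"
  by (simp add: sdp_objective_def congr_def)

lemma sdp_objective_mono: "loewner_le V W \<Longrightarrow> sdp_objective C D V \<le> sdp_objective C D W"
  unfolding sdp_objective_eq by (intro trace_mono loewner_le_congr)

lemma bounded_linear_sdp_objective: "bounded_linear (sdp_objective C D)"
  using bounded_linear_compose[OF bounded_linear_trace bounded_linear_congr[of "hcat C D"]]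
  unfolding sdp_objective_eq[abs_def] by (simp add: o_def)

text \<open>The map \<open>\<Phi>\<close> from the second moment of
  \<open>(x\<^sub>k, u\<^sub>k)\<close> to that of \<open>x\<^sub>k\<^sub>+\<^sub>1\<close>, written
  through \<open>congr\<close> so that monotonicity is inherited.\<close>

definition moment_step ::
  "real^'n^'n \<Rightarrow> real^'m^'n \<Rightarrow> nat \<Rightarrow> (nat \<Rightarrow> real^'n^'n) \<Rightarrow> real^('n + 'm)^('n + 'm) \<Rightarrow> real^'n^'n"
where
  "moment_step A B M As V =
     congr (hcat A B) V + (\<Sum>i=1..M. congr (As i) (congr (hcat (mat 1) 0) V)) + mat 1"

lemma sdp_feasible_iff:
  "sdp_feasible A B M As V \<longleftrightarrow>
     pos_semidef V \<and> congr (hcat (mat 1) 0) V = moment_step A B M As V"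
proof -
  have "congr S (congr T V) = S ** T ** V ** transpose T ** transpose S"
    for S :: "real^'a^'a" and T :: "real^('a+'b)^'a"
    by (simp add: congr_def matrix_mul_assoc)
  then show ?thesis
    unfolding sdp_feasible_def moment_step_def Let_def by (simp add: congr_def)
qed

lemma moment_step_mono:
  "loewner_le V W \<Longrightarrow> loewner_le (moment_step A B M As V) (moment_step A B M As W)"
  unfolding moment_step_def
  by (intro loewner_le_add loewner_le_sum loewner_le_congr loewner_le_refl)

text \<open>The map is monotone and its value at 0 is the covariance of the additive noise.\<close>

lemma mat_1_le_moment_step:
  assumes "loewner_le 0 V"
  shows "loewner_le (mat 1) (moment_step A B M As V)"
proof -
  have "moment_step A B M As 0 = mat 1" by (simp add: moment_step_def congr_def)
  with moment_step_mono[OF assms, of A B M As] show ?thesis by simp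
qed

text \<open>The constraint makes \<open>X\<close> a value of \<open>moment_step\<close> at a
  positive semidefinite matrix, so \<open>X\<close> dominates the identity.\<close>

lemma pos_def_of_feasible:
  assumes "sdp_feasible A B M As (vcat (hcat X R) (hcat (transpose R) U))"
  shows "pos_def X"
proof -
  let ?V = "vcat (hcat X R) (hcat (transpose R) U)"
  have V: "pos_semidef ?V" and X: "X = moment_step A B M As ?V"
    using assms by (simp_all add: sdp_feasible_iff congr_projection_block)
  have "transpose ?V $ Inl a $ Inl b = ?V $ Inl a $ Inl b" for a b
    using V unfolding pos_semidef_def by simp
  then have "transpose X = X"
    by (simp add: vec_eq_iff transpose_def vcat_def hcat_def)
  moreover have "0 < x \<bullet> (X *v x)" if "x \<noteq> 0" for x
  proof -
    have "loewner_le 0 ?V" using V by (simp add: pos_semidef_def loewner_le_def)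
    then have "loewner_le (mat 1) X" by (subst X) (rule mat_1_le_moment_step)
    then have "x \<bullet> x \<le> x \<bullet> (X *v x)"
      unfolding loewner_le_def by (metis matrix_vector_mul_lid)
    moreover have "0 < x \<bullet> x" using that by simp
    ultimately show ?thesis by linarith
  qed
  ultimately show ?thesis by (simp add: pos_def_def)
qed

section \<open>The system driven by the noise\<close>

locale controlled_noise = noise P M w \<sigma>
  for P :: "'a measure" and M :: nat and w :: "nat \<Rightarrow> 'a \<Rightarrow> real^'n" and \<sigma> +
  fixes A :: "real^'n^'n" and B :: "real^'m^'n" and As :: "nat \<Rightarrow> real^'n^'n"
begin

abbreviation "st \<equiv> state A B M As w \<sigma>"
abbreviation "inp \<equiv> input A B M As w \<sigma>"
abbreviation "adm \<equiv> admissible P A B M As w \<sigma>"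
abbreviation "proj \<equiv> hcat (mat 1 :: real^'n^'n) (0 :: real^'m^'n)"
abbreviation "step \<equiv> moment_step A B M As"

text \<open>The coefficient of \<open>scalar_noise k s\<close> in the expansion of
  \<open>x\<^sub>k\<^sub>+\<^sub>1\<close>.\<close>

definition driven :: "('n, 'm) policy \<Rightarrow> nat \<Rightarrow> (nat + 'n) option \<Rightarrow> 'a \<Rightarrow> real^'n" where
  "driven \<mu> k s \<omega> =
     (case s of None \<Rightarrow> A *v st \<mu> k \<omega> + B *v inp \<mu> k \<omega>
      | Some (Inl i) \<Rightarrow> As i *v st \<mu> k \<omega>
      | Some (Inr b) \<Rightarrow> axis b 1)"

definition joint :: "('n, 'm) policy \<Rightarrow> nat \<Rightarrow> 'a \<Rightarrow> real^('n + 'm)" where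
  "joint \<mu> k \<omega> = join (st \<mu> k \<omega>) (inp \<mu> k \<omega>)"

lemma state_Suc_slots:
  "st \<mu> (Suc k) \<omega> = (\<Sum>s\<in>slots. scalar_noise k s \<omega> *\<^sub>R driven \<mu> k s \<omega>)"
proof -
  have lin: "(\<Sum>i\<in>I. c i *\<^sub>R As i) *v x = (\<Sum>i\<in>I. c i *\<^sub>R (As i *v x))" for c x and I :: "nat set"
    by (induction I rule: infinite_finite_induct)
       (simp_all add: matrix_vector_mult_add_rdistrib scaleR_matrix_vector_assoc)
  have "(\<Sum>b\<in>UNIV. v $ b *\<^sub>R axis b 1) = v" for v :: "real^'n"
    using basis_expansion[of v] by (simp add: scalar_mult_eq_scaleR)
  then show ?thesis
    by (simp add: state_Suc sum_slots scalar_noise_def driven_def matrix_vector_mult_add_rdistrib lin)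
qed

lemma input_measurable_of_states:
  assumes "\<mu> k \<in> borel_measurable (Pi\<^sub>M {..k} (\<lambda>_. borel))"
    and "\<And>j. j \<le> k \<Longrightarrow> st \<mu> j \<in> borel_measurable N"
  shows "inp \<mu> k \<in> borel_measurable N"
proof -
  have "(\<lambda>\<omega>. \<lambda>j\<in>{..k}. st \<mu> j \<omega>) \<in> measurable N (Pi\<^sub>M {..k} (\<lambda>_. borel))"
    using assms(2) by (intro measurable_restrict) auto
  from measurable_compose[OF this assms(1)] show ?thesis
    by (simp add: input_def[abs_def])
qed

lemma driven_measurable:
  assumes "st \<mu> k \<in> borel_measurable N" "inp \<mu> k \<in> borel_measurable N"
  shows "driven \<mu> k s \<in> borel_measurable N"
proof (cases s)
  case (Some t)
  then show ?thesis
    by (cases t) (simp_all add: driven_def[abs_def] matrix_vector_measurable assms)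
qed (simp add: driven_def[abs_def] borel_measurable_add matrix_vector_measurable assms)

text \<open>Strong induction, because the input at time \<open>j\<close> reads all states up to
  \<open>j\<close>; the step to \<open>Suc j\<close> adds only the noise \<open>present j\<close>,
  contained in \<open>past (Suc j)\<close>.\<close>

lemma state_measurable:
  assumes "\<And>j. j < k \<Longrightarrow> \<mu> j \<in> borel_measurable (Pi\<^sub>M {..j} (\<lambda>_. borel))"
  shows "st \<mu> k \<in> borel_measurable (noise_algebra (past k))"
  using assms
proof (induction k rule: less_induct)
  case (less k)
  show ?case
  proof (cases k)
    case 0
    then show ?thesis by (simp add: state_0[abs_def])
  next
    case (Suc j)
    let ?N = "noise_algebra (past (Suc j))"
    have st: "st \<mu> i \<in> borel_measurable ?N" if "i \<le> j" for i
    proof (rule noise_algebra_measurable_mono)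
      show "past i \<subseteq> past (Suc j)" using that by (intro past_present) simp
      show "st \<mu> i \<in> borel_measurable (noise_algebra (past i))"
        using less that Suc by simp
    qed
    have "inp \<mu> j \<in> borel_measurable ?N"
      by (rule input_measurable_of_states[OF _ st]) (use less.prems Suc in auto)
    then have "driven \<mu> j s \<in> borel_measurable ?N" for s
      by (intro driven_measurable st) auto
    moreover have "scalar_noise j s \<in> borel_measurable ?N" if "s \<in> slots" for s
      by (rule noise_algebra_measurable_mono[OF past_present(5) scalar_noise_measurable[OF that]])
    ultimately show ?thesis
      unfolding Suc state_Suc_slots[abs_def]
      by (intro borel_measurable_sum borel_measurable_scaleR)
  qed
qed

lemma input_measurable:
  assumes "\<And>j. j \<le> k \<Longrightarrow> \<mu> j \<in> borel_measurable (Pi\<^sub>M {..j} (\<lambda>_. borel))"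
  shows "inp \<mu> k \<in> borel_measurable (noise_algebra (past k))"
proof (rule input_measurable_of_states)
  fix j assume j: "j \<le> k"
  show "st \<mu> j \<in> borel_measurable (noise_algebra (past k))"
    by (rule noise_algebra_measurable_mono[OF past_present(4)[OF j] state_measurable])
       (use assms j in simp)
qed (use assms in simp)

lemma admissible_input:
  assumes "adm N \<mu>" "k < N"
  shows "square_integrable P (inp \<mu> k)"
proof -
  have "inp \<mu> k \<in> borel_measurable (noise_algebra (past k))"
    by (rule input_measurable) (use assms in \<open>simp add: admissible_def\<close>)
  then show ?thesis
    using assms noise_algebra_measurable[OF past_present(1)]
    by (simp add: square_integrable_def admissible_def)
qed

lemma admissible_driven:
  assumes "adm N \<mu>" "k < N" "square_integrable P (st \<mu> k)"
  shows "driven \<mu> k s \<in> borel_measurable (noise_algebra (past k))"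
    and "square_integrable P (driven \<mu> k s)"
proof -
  show "driven \<mu> k s \<in> borel_measurable (noise_algebra (past k))"
    by (intro driven_measurable state_measurable input_measurable)
       (use assms in \<open>simp_all add: admissible_def\<close>)
  show "square_integrable P (driven \<mu> k s)"
  proof (cases s)
    case None
    then show ?thesis
      by (simp add: driven_def[abs_def] square_integrable_add square_integrable_matrix_vector
          assms(3) admissible_input[OF assms(1,2)])
  next
    case (Some t)
    have "square_integrable P (\<lambda>_. axis b 1 :: real^'n)" for b
      by (simp add: square_integrable_def)
    with Some show ?thesis
      by (cases t) (simp_all add: driven_def[abs_def] square_integrable_matrix_vector assms(3))
  qed
qed

text \<open>The range reaches \<open>k = N\<close>, one further than for inputs: the state at time
  \<open>N\<close> involves only the inputs before \<open>N\<close>.\<close>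

lemma admissible_state:
  assumes "adm N \<mu>" "k \<le> N"
  shows "square_integrable P (st \<mu> k)"
  using assms(2)
proof (induction k)
  case 0
  then show ?case by (simp add: state_0[abs_def] square_integrable_def)
next
  case (Suc k)
  then have "k < N" "square_integrable P (st \<mu> k)" by simp_all
  from moment_noise_sum(1)[OF admissible_driven[OF assms(1) this]]
  show ?case by (simp add: state_Suc_slots[abs_def])
qed

lemma admissible_joint:
  assumes "adm N \<mu>" "k < N"
  shows "square_integrable P (joint \<mu> k)"
  unfolding joint_def[abs_def]
  using square_integrable_join[OF admissible_state[OF assms(1)] admissible_input[OF assms]] assms(2)
  by simp

lemma proj_moment_joint:
  assumes "adm N \<mu>" "k < N"
  shows "congr proj (moment P (joint \<mu> k)) = moment P (st \<mu> k)"
  unfolding congr_moment[OF admissible_joint[OF assms]] by (simp add: joint_def hcat_join)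

text \<open>Each kind of slot yields one term of \<open>moment_step\<close>: the constant gives the
  drift, the \<open>\<sigma> k i\<close> the terms with \<open>As i\<close>, and the coordinates of
  \<open>w k\<close> the identity.\<close>

lemma moment_state_Suc:
  assumes "adm N \<mu>" "k < N"
  shows "moment P (st \<mu> (Suc k)) = step (moment P (joint \<mu> k))"
proof -
  have st: "square_integrable P (st \<mu> k)" using assms admissible_state[of N \<mu> k] by simp
  have "moment P (st \<mu> (Suc k)) = (\<Sum>s\<in>slots. moment P (driven \<mu> k s))"
    unfolding state_Suc_slots[abs_def]
    by (rule moment_noise_sum(2)[OF admissible_driven[OF assms st]])
  also have "\<dots> = moment P (\<lambda>\<omega>. A *v st \<mu> k \<omega> + B *v inp \<mu> k \<omega>)
      + ((\<Sum>i=1..M. moment P (\<lambda>\<omega>. As i *v st \<mu> k \<omega>)) + (\<Sum>b\<in>UNIV. outer (axis b 1) (axis b 1)))"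
    unfolding sum_slots by (simp add: driven_def[abs_def] moment_def prob_space)
  also have "\<dots> = step (moment P (joint \<mu> k))"
    unfolding moment_step_def proj_moment_joint[OF assms] congr_moment[OF admissible_joint[OF assms]]
      congr_moment[OF st] sum_outer_axis
    by (simp add: joint_def hcat_join add.assoc congr_moment[OF st])
  finally show ?thesis .
qed

lemma average_cost_eq:
  assumes "adm N \<mu>"
  shows "average_cost P A B C D M As w \<sigma> N \<mu>
    = (1 / real N) * (\<Sum>k<N. sdp_objective C D (moment P (joint \<mu> k)))"
proof -
  have "sdp_objective C D (moment P (joint \<mu> k))
      = (\<integral>\<omega>. (let z = C *v st \<mu> k \<omega> + D *v inp \<mu> k \<omega> in z \<bullet> z) \<partial>P)" if "k < N" for k
    unfolding sdp_objective_eq congr_moment[OF admissible_joint[OF assms that]]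
      trace_moment[OF square_integrable_matrix_vector[OF admissible_joint[OF assms that]]]
    by (simp add: joint_def hcat_join Let_def)
  then show ?thesis by (simp add: average_cost_def)
qed

section \<open>Upper bound by a linear policy\<close>

lemma linear_policy_bound:
  assumes V: "sdp_feasible A B M As (vcat (hcat X R) (hcat (transpose R) U))" (is "sdp_feasible _ _ _ _ ?V")
  defines "\<mu> \<equiv> linear_policy (transpose R ** matrix_inv X)"
  shows "adm N \<mu>"
    and "0 < N \<Longrightarrow> average_cost P A B C D M As w \<sigma> N \<mu> \<le> sdp_objective C D ?V"
proof -
  let ?K = "transpose R ** matrix_inv X"
  let ?G = "vcat (mat 1) ?K"
  have inp: "inp \<mu> k \<omega> = ?K *v st \<mu> k \<omega>" for k \<omega>
    by (simp add: input_def \<mu>_def linear_policy_def)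
  \<comment> \<open>Admissibility up to \<open>N\<close> makes the state at time \<open>N\<close>
    square-integrable, hence also the next input; this forces an induction on the horizon.\<close>
  show adm: "adm N \<mu>" for N
  proof (induction N)
    case 0
    show ?case by (simp add: admissible_def)
  next
    case (Suc N)
    have "\<mu> N \<in> borel_measurable (Pi\<^sub>M {..N} (\<lambda>_. borel))"
      unfolding \<mu>_def linear_policy_def[abs_def]
      by (intro matrix_vector_measurable measurable_component_singleton) simp
    moreover have "square_integrable P (inp \<mu> N)"
      unfolding inp[abs_def]
      by (intro square_integrable_matrix_vector admissible_state[OF Suc.IH]) simp
    ultimately show ?case
      using Suc.IH by (auto simp: admissible_def less_Suc_eq square_integrable_def)
  qed
  have psd: "pos_semidef ?V" and X: "X = step ?V"
    using V by (simp_all add: sdp_feasible_iff congr_projection_block)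
  have gain: "loewner_le (congr ?G X) ?V"
    by (rule congr_gain_le[OF pos_def_of_feasible[OF V] psd])
  have joint: "moment P (joint \<mu> k) = congr ?G (moment P (st \<mu> k))" for k
    using congr_moment[OF admissible_state[OF adm[of k]], of k ?G]
    by (simp add: joint_def[abs_def] inp vcat_mult_vec)
  \<comment> \<open>With \<open>G = [I; K]\<close> the induction step is the chain
    \<open>X\<^sub>k\<^sub>+\<^sub>1 = \<Phi>(G X\<^sub>k G\<^sup>T) \<le> \<Phi>(G X G\<^sup>T)
    \<le> \<Phi>(V) = X\<close>.\<close>
  have bound: "loewner_le (moment P (st \<mu> k)) X" for k
  proof (induction k)
    case 0
    have "moment P (st \<mu> 0) = 0"
      by (simp add: state_0[abs_def] moment_def bounded_bilinear.zero_left[OF bounded_bilinear_outer])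
    then show ?case
      using pos_def_of_feasible[OF V] unfolding pos_def_def loewner_le_def
      by (metis inner_zero_left inner_zero_right less_eq_real_def matrix_vector_mult_0)
  next
    case (Suc k)
    have "moment P (st \<mu> (Suc k)) = step (congr ?G (moment P (st \<mu> k)))"
      using moment_state_Suc[OF adm, of k "Suc k"] by (simp add: joint)
    also have "loewner_le \<dots> (step (congr ?G X))"
      by (intro moment_step_mono loewner_le_congr Suc.IH)
    finally show ?case
      using loewner_le_trans[OF _ moment_step_mono[OF gain, of A B M As]] X by metis
  qed
  have "sdp_objective C D (moment P (joint \<mu> k)) \<le> sdp_objective C D ?V" for k
    unfolding joint by (rule sdp_objective_mono[OF loewner_le_trans[OF loewner_le_congr[OF bound] gain]])
  then have "(\<Sum>k<N. sdp_objective C D (moment P (joint \<mu> k))) \<le> real N * sdp_objective C D ?V"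
    using sum_bounded_above[of "{..<N}" "\<lambda>k. sdp_objective C D (moment P (joint \<mu> k))"
        "sdp_objective C D ?V"] by simp
  then show "average_cost P A B C D M As w \<sigma> N \<mu> \<le> sdp_objective C D ?V" if "0 < N"
    using that by (simp add: average_cost_eq[OF adm] field_simps)
qed

subsection \<open>Lower bound by averaging\<close>

text \<open>The constraint is affine with constant part \<open>mat 1\<close>; once that is
  subtracted, its residual commutes with averages and limits.\<close>

lemma bounded_linear_step_residual: "bounded_linear (\<lambda>V. step V - congr proj V - mat 1)"
proof -
  have "bounded_linear (\<lambda>V. congr (hcat A B) V + (\<Sum>i=1..M. congr (As i) (congr proj V)) - congr proj V)"
    by (intro bounded_linear_sub bounded_linear_add bounded_linear_sum bounded_linear_congr
        bounded_linear_compose[OF bounded_linear_congr bounded_linear_congr])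
  then show ?thesis by (simp add: moment_step_def algebra_simps)
qed

text \<open>The time average of the moment matrices solves the semidefinite constraint up to
  \<open>E[x\<^sub>T x\<^sub>T\<^sup>T] / T\<close>. Among the last \<open>m\<close> times of the horizon there is a \<open>T\<close> at which
  this error is at most the average over those times.\<close>

lemma almost_feasible_average:
  fixes C :: "real^'n^'p" and D :: "real^'m^'p"
  assumes l: "0 < l" "\<And>z. l * (norm z)\<^sup>2 \<le> (hcat C D *v z) \<bullet> (hcat C D *v z)"
    and adm: "adm N \<mu>" and cost: "average_cost P A B C D M As w \<sigma> N \<mu> \<le> c"
    and m: "0 < m" "m < N"
  obtains V where "pos_semidef V" "norm V \<le> c * N / (l * (N - m))"
    "sdp_objective C D V \<le> c * N / (N - m)"
    "norm (step V - congr proj V) \<le> c * N / (l * m * (N - m))"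
proof -
  define V where "V k = moment P (joint \<mu> k)" for k
  define a where "a k = (\<integral>\<omega>. joint \<mu> k \<omega> \<bullet> joint \<mu> k \<omega> \<partial>P)" for k
  note J = admissible_joint[OF adm]
  have a0: "0 \<le> a k" for k by (simp add: a_def)
  \<comment> \<open>Coercivity: the stage cost controls the full second moment of state and
    input.\<close>
  have la: "l * a k \<le> sdp_objective C D (V k)" if "k < N" for k
  proof -
    have "sdp_objective C D (V k) = (\<integral>\<omega>. (hcat C D *v joint \<mu> k \<omega>) \<bullet> (hcat C D *v joint \<mu> k \<omega>) \<partial>P)"
      unfolding V_def sdp_objective_eq congr_moment[OF J[OF that]]
      by (rule trace_moment[OF square_integrable_matrix_vector[OF J[OF that]]])
    moreover have "integrable P (\<lambda>\<omega>. l * (norm (joint \<mu> k \<omega>))\<^sup>2)"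
      "integrable P (\<lambda>\<omega>. (hcat C D *v joint \<mu> k \<omega>) \<bullet> (hcat C D *v joint \<mu> k \<omega>))"
      using J[OF that] square_integrable_matrix_vector[OF J[OF that], of "hcat C D"]
      by (simp_all add: square_integrable_def power2_norm_eq_inner)
    ultimately show ?thesis
      using integral_mono[of P "\<lambda>\<omega>. l * (norm (joint \<mu> k \<omega>))\<^sup>2"] l(2)
      by (simp add: a_def power2_norm_eq_inner)
  qed
  have obj0: "0 \<le> sdp_objective C D (V k)" if "k < N" for k
    using la[OF that] l(1) a0[of k] by (meson mult_nonneg_nonneg less_imp_le order_trans)
  have total: "(\<Sum>k<N. sdp_objective C D (V k)) \<le> c * N"
    using cost m average_cost_eq[OF adm, of C D] by (simp add: V_def field_simps)
  have part: "(\<Sum>k\<in>K. sdp_objective C D (V k)) \<le> c * N" if "K \<subseteq> {..<N}" for K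
    using sum_mono2[OF _ that, of "\<lambda>k. sdp_objective C D (V k)"] obj0 total by force
  have parta: "l * (\<Sum>k\<in>K. a k) \<le> c * N" if "K \<subseteq> {..<N}" for K
  proof -
    have "l * (\<Sum>k\<in>K. a k) \<le> (\<Sum>k\<in>K. sdp_objective C D (V k))"
      unfolding sum_distrib_left by (rule sum_mono) (use la that in auto)
    with part[OF that] show ?thesis by linarith
  qed
  \<comment> \<open>Pigeonhole: not all of the last \<open>m\<close> values can exceed their
    mean.\<close>
  have "\<exists>T\<in>{N - m..<N}. m * a T \<le> (\<Sum>k=N - m..<N. a k)"
  proof (rule ccontr)
    assume "\<not> ?thesis"
    then have "(\<Sum>k=N - m..<N. (\<Sum>k=N - m..<N. a k)) < (\<Sum>k=N - m..<N. m * a k)"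
      using m by (intro sum_strict_mono) (auto simp: not_le)
    then show False using m by (simp add: sum_distrib_left)
  qed
  then obtain T where T: "N - m \<le> T" "T < N" "m * a T \<le> (\<Sum>k=N - m..<N. a k)" by auto
  have "l * (m * a T) \<le> l * (\<Sum>k=N - m..<N. a k)"
    using T(3) l(1) by (intro mult_left_mono) auto
  also have "\<dots> \<le> c * N" by (rule parta) auto
  finally have aT: "l * m * a T \<le> c * N" by (simp add: mult.assoc)
  have T0: "0 < T" and NT: "0 < N - m" "real N - real m \<le> T" using T m by linarith+
  \<comment> \<open>The empty sum yields the sign, as all stage costs are nonnegative.\<close>
  have cN: "0 \<le> c * N" using part[of "{}"] by simp
  \<comment> \<open>Averaging stops at the chosen \<open>T\<close>, so the boundary term left by
    telescoping is the small one; \<open>T \<ge> N - m\<close> makes the bounds uniform in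
    \<open>T\<close>.\<close>
  define W where "W = (1 / T) *\<^sub>R (\<Sum>k<T. V k)"
  have psd: "pos_semidef W"
  proof -
    have "pos_semidef (V k)" if "k < T" for k
      using pos_semidef_moment[OF J] that T by (simp add: V_def)
    then have "transpose (V k) = V k" "0 \<le> x \<bullet> (V k *v x)" if "k < T" for k x
      using that by (simp_all add: pos_semidef_def)
    moreover have "transpose (\<Sum>k<T. V k) = (\<Sum>k<T. transpose (V k))"
      by (simp add: vec_eq_iff transpose_def)
    moreover have "(\<Sum>k<t. V k) *v x = (\<Sum>k<t. V k *v x)" for x t
      by (induction t) (simp_all add: matrix_vector_mult_add_rdistrib)
    ultimately show ?thesis
      unfolding pos_semidef_def W_def
      by (simp add: transpose_scalar scaleR_matrix_vector_assoc[symmetric] inner_sum_right)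
         (auto intro!: divide_nonneg_nonneg sum_nonneg)
  qed
  have normW: "norm W \<le> c * N / (l * (N - m))"
  proof -
    have "norm W \<le> (1 / T) * (\<Sum>k<T. a k)"
      unfolding W_def using sum_norm_le[of "{..<T}" V a] norm_moment_le[of P "joint \<mu> _"]
      by (simp add: V_def a_def divide_right_mono)
    also have "\<dots> \<le> (1 / T) * (c * N / l)"
      using parta[of "{..<T}"] T l(1) by (intro mult_left_mono) (auto simp: field_simps)
    also have "\<dots> = (c * N / l) / T" by simp
    also have "\<dots> \<le> (c * N / l) / (N - m)"
      using cN l(1) NT m by (intro divide_left_mono) auto
    finally show ?thesis by (simp add: mult_ac)
  qed
  have objW: "sdp_objective C D W \<le> c * N / (N - m)"
  proof -
    interpret bounded_linear "sdp_objective C D" by (rule bounded_linear_sdp_objective)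
    have "sdp_objective C D W = (\<Sum>k<T. sdp_objective C D (V k)) / T"
      by (simp add: W_def scaleR sum)
    also have "\<dots> \<le> c * N / T"
      using part[of "{..<T}"] T by (intro divide_right_mono) auto
    also have "\<dots> \<le> c * N / (N - m)"
      using cN NT m by (intro divide_left_mono) auto
    finally show ?thesis .
  qed
  have res: "norm (step W - congr proj W) \<le> c * N / (l * m * (N - m))"
  proof -
    interpret bounded_linear "\<lambda>V. step V - congr proj V - mat 1"
      by (rule bounded_linear_step_residual)
    have "step W - congr proj W - mat 1 = (1 / T) *\<^sub>R (\<Sum>k<T. step (V k) - congr proj (V k) - mat 1)"
      unfolding W_def scaleR sum ..
    \<comment> \<open>Both sides of the constraint become consecutive state moments, so the sum
      telescopes.\<close>
    also have "\<dots> = (1 / T) *\<^sub>R (\<Sum>k<T. moment P (st \<mu> (Suc k)) - moment P (st \<mu> k) - mat 1)"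
      using T by (simp add: V_def moment_state_Suc[OF adm] proj_moment_joint[OF adm])
    also have "(\<Sum>k<T. moment P (st \<mu> (Suc k)) - moment P (st \<mu> k) - mat 1)
        = moment P (st \<mu> T) - moment P (st \<mu> 0) - real T *\<^sub>R mat 1"
      by (simp only: sum_subtractf[of _ "\<lambda>_. mat 1"] sum_lessThan_telescope[of "\<lambda>k. moment P (st \<mu> k)"]
          sum_constant_scaleR card_lessThan)
    also have "moment P (st \<mu> 0) = 0"
      by (simp add: state_0[abs_def] moment_def bounded_bilinear.zero_left[OF bounded_bilinear_outer])
    finally have "step W - congr proj W = (1 / T) *\<^sub>R moment P (st \<mu> T)"
      using T0 by (simp add: scaleR_diff_right)
    \<comment> \<open>The state is a part of the joint vector; \<open>T < N\<close> ensures that the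
      input at \<open>T\<close> is still square-integrable.\<close>
    moreover have "norm (moment P (st \<mu> T)) \<le> a T"
    proof -
      have "norm (moment P (st \<mu> T)) \<le> (\<integral>\<omega>. st \<mu> T \<omega> \<bullet> st \<mu> T \<omega> \<partial>P)" by (rule norm_moment_le)
      also have "\<dots> \<le> a T"
        unfolding a_def
        by (rule integral_mono)
           (use admissible_state[OF adm, of T] J[OF T(2)] T(2)
             in \<open>simp_all add: square_integrable_def power2_norm_eq_inner joint_def inner_join\<close>)
      finally show ?thesis .
    qed
    ultimately have "norm (step W - congr proj W) \<le> a T / T"
      by (simp add: divide_right_mono)
    also have "\<dots> \<le> (c * N / (l * m)) / T"
      using aT l(1) m by (intro divide_right_mono) (auto simp: field_simps)
    also have "\<dots> \<le> (c * N / (l * m)) / (N - m)"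
      using cN l(1) NT m by (intro divide_left_mono) auto
    finally show ?thesis by (simp add: mult_ac)
  qed
  show ?thesis
    using that[OF psd normW objW res] .
qed

text \<open>This is where the positive definiteness of \<open>[C D]\<^sup>T [C D]\<close> enters:
  bounded cost then means bounded moments.\<close>

lemma quadratic_lower_bound:
  fixes C :: "real^'n^'p" and D :: "real^'m^'p"
  assumes "pos_def (transpose (hcat C D) ** hcat C D)"
  obtains l where "0 < l" "\<And>z. l * (norm z)\<^sup>2 \<le> (hcat C D *v z) \<bullet> (hcat C D *v z)"
proof -
  have "z \<bullet> ((transpose (hcat C D) ** hcat C D) *v z) = (hcat C D *v z) \<bullet> (hcat C D *v z)" for z
    by (simp add: matrix_vector_mul_assoc[symmetric] inner_commute[of z] dot_lmul_matrix)
  with pos_def_quadratic_bound[OF assms] that show ?thesis by metis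
qed

text \<open>Almost feasible averages form a bounded sequence, and any limit point satisfies the
  constraint exactly. The same \<open>c\<close> survives because the loss factors
  \<open>?e j\<close> tend to 1.\<close>

lemma feasible_of_frequently_cheap:
  fixes C :: "real^'n^'p" and D :: "real^'m^'p"
  assumes pd: "pos_def (transpose (hcat C D) ** hcat C D)"
    and freq: "\<And>n. \<exists>N\<ge>n. \<exists>\<mu>. adm N \<mu> \<and> average_cost P A B C D M As w \<sigma> N \<mu> \<le> c"
  obtains V where "sdp_feasible A B M As V" "sdp_objective C D V \<le> c"
proof -
  \<comment> \<open>With \<open>m = Suc j\<close> and \<open>N \<ge> m + m\<^sup>2\<close> the errors of the almost feasible averages vanish as \<open>j\<close> grows.\<close>
  obtain l where l: "0 < l" "\<And>z. l * (norm z)\<^sup>2 \<le> (hcat C D *v z) \<bullet> (hcat C D *v z)"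
    using quadratic_lower_bound[OF pd] by blast
  let ?e = "\<lambda>j. 1 + 1 / real (Suc j)"
  have "\<exists>V. pos_semidef V \<and> norm V \<le> (c / l) * ?e j \<and> sdp_objective C D V \<le> c * ?e j \<and>
      norm (step V - congr proj V) \<le> (c / l) * ?e j / real (Suc j)" for j
  proof -
    obtain N \<mu> where N: "Suc j + Suc j * Suc j \<le> N" "adm N \<mu>"
      "average_cost P A B C D M As w \<sigma> N \<mu> \<le> c" using freq by blast
    have m: "0 < Suc j" "Suc j < N" using N(1) by auto
    obtain V where V: "pos_semidef V" "norm V \<le> c * N / (l * (N - Suc j))"
      "sdp_objective C D V \<le> c * N / (N - Suc j)"
      "norm (step V - congr proj V) \<le> c * N / (l * Suc j * (N - Suc j))"
      using almost_feasible_average[OF l N(2,3) m] by blast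
    have NJ: "real (Suc j) * real (Suc j) \<le> real (N - Suc j)" "0 < real (N - Suc j)"
    proof -
      have "Suc j * Suc j \<le> N - Suc j" using N(1) by linarith
      then show "real (Suc j) * real (Suc j) \<le> real (N - Suc j)"
        unfolding of_nat_mult[symmetric] of_nat_le_iff .
    qed (use m(2) in simp)
    \<comment> \<open>With \<open>m = Suc j\<close>, the choice of \<open>N\<close> gives
      \<open>N - m \<ge> m * m\<close>, so the last fraction is at most
      \<open>1 / m\<close>.\<close>
    have "real N / (N - Suc j) = 1 + real (Suc j) / (N - Suc j)"
      using m(2) by (simp add: field_simps of_nat_diff)
    also have "real (Suc j) / (N - Suc j) \<le> 1 / Suc j"
      using NJ by (simp add: field_simps)
    finally have q: "real N / (N - Suc j) \<le> ?e j" by simp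
    \<comment> \<open>The sign of \<open>c\<close> is recovered from the bound on a norm.\<close>
    have "0 \<le> c * N / (l * (N - Suc j))" using V(2) norm_ge_zero order_trans by blast
    moreover have "0 < l * (N - Suc j)" using l(1) m(2) by simp
    ultimately have "0 \<le> c * N" by (simp only: zero_le_divide_iff) linarith
    then have c: "0 \<le> c" using m(2) by (simp add: zero_le_mult_iff)
    have "norm V \<le> (c / l) * (real N / (N - Suc j))" using V(2) by simp
    also have "\<dots> \<le> (c / l) * ?e j" using q c l(1) by (intro mult_left_mono) auto
    finally have 1: "norm V \<le> (c / l) * ?e j" .
    have "sdp_objective C D V \<le> c * (real N / (N - Suc j))" using V(3) by simp
    also have "\<dots> \<le> c * ?e j" using q c by (intro mult_left_mono) auto
    finally have 2: "sdp_objective C D V \<le> c * ?e j" .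
    have "norm (step V - congr proj V) \<le> (c / l) * (real N / (N - Suc j)) / Suc j"
      using V(4) by (simp add: mult_ac)
    also have "\<dots> \<le> (c / l) * ?e j / Suc j"
      using q c l(1) by (intro divide_right_mono mult_left_mono) auto
    finally show ?thesis using V(1) 1 2 by blast
  qed
  then obtain V where V: "\<And>j. pos_semidef (V j)" "\<And>j. norm (V j) \<le> (c / l) * ?e j"
    "\<And>j. sdp_objective C D (V j) \<le> c * ?e j"
    "\<And>j. norm (step (V j) - congr proj (V j)) \<le> (c / l) * ?e j / real (Suc j)" by metis
  have "bounded (range V)"
  proof (rule boundedI)
    fix S assume "S \<in> range V"
    then obtain j where j: "S = V j" by blast
    have "0 \<le> (c / l) * ?e 0" using V(2)[of 0] norm_ge_zero order_trans by blast
    then have "0 \<le> c / l" using l(1) by (simp add: zero_le_divide_iff)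
    then have "(c / l) * ?e j \<le> (c / l) * 2" by (intro mult_left_mono) (simp_all add: field_simps)
    from order_trans[OF V(2) this] show "norm S \<le> (c / l) * 2" by (simp only: j)
  qed
  then obtain W r where r: "strict_mono r" and lim: "(V \<circ> r) \<longlonglongrightarrow> W"
    using bounded_imp_convergent_subsequence by blast
  have lim_lin: "(\<lambda>i. f (V (r i))) \<longlonglongrightarrow> f W" if "bounded_linear f" for f :: "_ \<Rightarrow> 'x::real_normed_vector"
    using bounded_linear.tendsto[OF that lim] by (simp add: o_def)
  have e: "(\<lambda>i. ?e (r i)) \<longlonglongrightarrow> 1" "(\<lambda>i. (c / l) * ?e (r i) / real (Suc (r i))) \<longlonglongrightarrow> 0"
  proof -
    have inv: "(\<lambda>i. 1 / real (Suc (r i))) \<longlonglongrightarrow> 0"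
      using LIMSEQ_subseq_LIMSEQ[OF LIMSEQ_inverse_real_of_nat r] by (simp add: o_def inverse_eq_divide)
    from tendsto_add[OF tendsto_const[of 1] inv] show e: "(\<lambda>i. ?e (r i)) \<longlonglongrightarrow> 1" by simp
    from tendsto_mult[OF tendsto_mult[OF tendsto_const[of "c / l"] e] inv]
    show "(\<lambda>i. (c / l) * ?e (r i) / real (Suc (r i))) \<longlonglongrightarrow> 0" by simp
  qed
  have "pos_semidef W"
    unfolding pos_semidef_def
  proof (intro conjI allI)
    have "bounded_linear (transpose :: real^('n+'m)^('n+'m) \<Rightarrow> _)"
      unfolding linear_conv_bounded_linear[symmetric]
      by (rule linearI) (simp_all add: transpose_def vec_eq_iff)
    from lim_lin[OF this] have "(\<lambda>i. V (r i)) \<longlonglongrightarrow> transpose W"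
      using V(1) by (simp add: pos_semidef_def)
    then show "transpose W = W"
      using lim LIMSEQ_unique by (auto simp: o_def)
  next
    fix x
    from LIMSEQ_le_const[OF lim_lin[OF bounded_linear_quadratic_form], of 0] show "0 \<le> x \<bullet> (W *v x)"
      using V(1) by (simp add: pos_semidef_def)
  qed
  moreover have "congr proj W = step W"
  proof -
    \<comment> \<open>The identity is subtracted and restored because only the shifted residual is
      linear.\<close>
    have "(\<lambda>i. step (V (r i)) - congr proj (V (r i)) - mat 1 + mat 1) \<longlonglongrightarrow> step W - congr proj W - mat 1 + mat 1"
      by (intro tendsto_add tendsto_const lim_lin bounded_linear_step_residual)
    then have "(\<lambda>i. step (V (r i)) - congr proj (V (r i))) \<longlonglongrightarrow> step W - congr proj W"
      by simp
    moreover have "(\<lambda>i. step (V (r i)) - congr proj (V (r i))) \<longlonglongrightarrow> 0"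
      by (rule Lim_null_comparison[OF _ e(2)]) (intro always_eventually allI V(4))
    ultimately show ?thesis using LIMSEQ_unique by fastforce
  qed
  moreover have "sdp_objective C D W \<le> c"
  proof (rule LIMSEQ_le[OF lim_lin[OF bounded_linear_sdp_objective]])
    show "(\<lambda>i. c * ?e (r i)) \<longlonglongrightarrow> c"
      using tendsto_mult[OF tendsto_const[of c] e(1)] by simp
  qed (use V(3) in blast)
  ultimately show ?thesis using that by (simp add: sdp_feasible_iff)
qed

section \<open>Convergence of the optimal costs and optimality of the linear policy\<close>

lemma block_decomposition:
  fixes V :: "real^('n + 'm)^('n + 'm)"
  assumes "transpose V = V"
  obtains X R U where "V = vcat (hcat X R) (hcat (transpose R) U)"
proof -
  have sym: "V $ i $ j = V $ j $ i" for i j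
  proof -
    have "transpose V $ i $ j = V $ j $ i" by (simp add: transpose_def)
    then show ?thesis by (simp add: assms)
  qed
  have "V = vcat (hcat (\<chi> a b. V $ Inl a $ Inl b) (\<chi> a b. V $ Inl a $ Inr b))
      (hcat (transpose (\<chi> a b. V $ Inl a $ Inr b)) (\<chi> a b. V $ Inr a $ Inr b))"
    by (auto simp: vec_eq_iff vcat_def hcat_def transpose_def sym[of "Inr _" "Inl _"] split: sum.splits)
  then show ?thesis using that by blast
qed

text \<open>Valid at each positive horizon, not only in the limit: every feasible matrix yields a
  linear policy at most as expensive. Without feasible matrices the right side is
  \<open>\<infinity>\<close>.\<close>

lemma optimal_cost_le_sdp_value:
  fixes C :: "real^'n^'p" and D :: "real^'m^'p"
  assumes "0 < N"
  shows "optimal_cost P A B C D M As w \<sigma> N \<le> sdp_value A B C D M As"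
  unfolding sdp_value_def
proof (rule INF_greatest)
  fix V assume "V \<in> {V. sdp_feasible A B M As V}"
  then have V: "sdp_feasible A B M As V" by simp
  then have "transpose V = V" by (simp add: sdp_feasible_def pos_semidef_def)
  then obtain X R U where VX: "V = vcat (hcat X R) (hcat (transpose R) U)"
    by (rule block_decomposition)
  note lp = linear_policy_bound[OF V[unfolded VX]]
  have "optimal_cost P A B C D M As w \<sigma> N
      \<le> ereal (average_cost P A B C D M As w \<sigma> N (linear_policy (transpose R ** matrix_inv X)))"
    unfolding optimal_cost_def by (rule INF_lower) (simp add: lp)
  also have "\<dots> \<le> ereal (sdp_objective C D V)" using lp(2)[OF assms] VX by simp
  finally show "optimal_cost P A B C D M As w \<sigma> N \<le> ereal (sdp_objective C D V)" .
qed

text \<open>The upper half holds at each positive horizon. For the lower half, costs staying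
  infinitely often below the value would produce a feasible matrix below the value; the infeasible
  case is covered by the same contradiction.\<close>

lemma optimal_cost_tendsto:
  fixes C :: "real^'n^'p" and D :: "real^'m^'p"
  assumes pd: "pos_def (transpose (hcat C D) ** hcat C D)"
  shows "optimal_cost P A B C D M As w \<sigma> \<longlonglongrightarrow> sdp_value A B C D M As"
proof (rule order_tendstoI)
  fix b assume b: "b < sdp_value A B C D M As"
  show "\<forall>\<^sub>F N in sequentially. b < optimal_cost P A B C D M As w \<sigma> N"
  proof (rule ccontr)
    assume "\<not> ?thesis"
    then have freq: "\<exists>N\<ge>n. optimal_cost P A B C D M As w \<sigma> N \<le> b" for n
      unfolding eventually_sequentially by (meson linorder_not_le)
    \<comment> \<open>A real number strictly in between is needed: \<open>b\<close> may be
      \<open>-\<infinity>\<close>, and the infimum over policies need not be attained.\<close>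
    obtain c where c: "b < ereal c" "ereal c < sdp_value A B C D M As"
      using ereal_dense2[OF b] by blast
    have "\<exists>N\<ge>n. \<exists>\<mu>. adm N \<mu> \<and> average_cost P A B C D M As w \<sigma> N \<mu> \<le> c" for n
    proof -
      obtain N where N: "n \<le> N" "optimal_cost P A B C D M As w \<sigma> N < ereal c"
        using freq c(1) by (meson order_le_less_trans)
      then obtain \<mu> where "adm N \<mu>" "average_cost P A B C D M As w \<sigma> N \<mu> < c"
        unfolding optimal_cost_def INF_less_iff by auto
      with N(1) show ?thesis by (meson less_imp_le)
    qed
    then obtain V where "sdp_feasible A B M As V" "sdp_objective C D V \<le> c"
      using feasible_of_frequently_cheap[OF pd] by blast
    then have "sdp_value A B C D M As \<le> ereal c"
      unfolding sdp_value_def by (intro INF_lower2[of V]) auto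
    with c(2) show False by simp
  qed
next
  fix b assume "sdp_value A B C D M As < b"
  then have "optimal_cost P A B C D M As w \<sigma> N < b" if "1 \<le> N" for N
    using optimal_cost_le_sdp_value[of N C D] that by (simp add: order_le_less_trans)
  then show "\<forall>\<^sub>F N in sequentially. optimal_cost P A B C D M As w \<sigma> N < b"
    unfolding eventually_sequentially by blast
qed

text \<open>The cost is squeezed between the optimal cost, by admissibility, and the semidefinite
  value, to which the objective at an optimal matrix is equal.\<close>

lemma linear_policy_optimal:
  fixes C :: "real^'n^'p" and D :: "real^'m^'p"
  assumes pd: "pos_def (transpose (hcat C D) ** hcat C D)"
    and opt: "sdp_optimal A B C D M As (vcat (hcat X R) (hcat (transpose R) U))"
  shows "(\<lambda>N. ereal (average_cost P A B C D M As w \<sigma> N (linear_policy (transpose R ** matrix_inv X))))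
    \<longlonglongrightarrow> sdp_value A B C D M As"
proof (rule tendsto_sandwich[OF _ _ optimal_cost_tendsto[OF pd] tendsto_const])
  let ?V = "vcat (hcat X R) (hcat (transpose R) U)"
  let ?\<mu> = "linear_policy (transpose R ** matrix_inv X)"
  have V: "sdp_feasible A B M As ?V"
    and min: "\<And>V'. sdp_feasible A B M As V' \<Longrightarrow> sdp_objective C D ?V \<le> sdp_objective C D V'"
    using opt by (auto simp: sdp_optimal_def)
  note lp = linear_policy_bound[OF V]
  show "\<forall>\<^sub>F N in sequentially. optimal_cost P A B C D M As w \<sigma> N
      \<le> ereal (average_cost P A B C D M As w \<sigma> N ?\<mu>)"
    unfolding optimal_cost_def by (intro always_eventually allI INF_lower) (simp add: lp)
  have "ereal (sdp_objective C D ?V) \<le> sdp_value A B C D M As"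
    unfolding sdp_value_def by (rule INF_greatest) (simp add: min)
  then have "ereal (average_cost P A B C D M As w \<sigma> N ?\<mu>) \<le> sdp_value A B C D M As" if "1 \<le> N" for N
    using lp(2)[of N C D] that by (meson ereal_less_eq(3) less_le_trans order_trans zero_less_one)
  then show "\<forall>\<^sub>F N in sequentially. ereal (average_cost P A B C D M As w \<sigma> N ?\<mu>) \<le> sdp_value A B C D M As"
    unfolding eventually_sequentially by blast
qed

end

theorem theorem3:
  fixes P :: "'a measure"
    and A :: "real^'n^'n" and B :: "real^'m^'n"
    and C :: "real^'n^'p" and D :: "real^'m^'p"
    and M :: nat and As :: "nat \<Rightarrow> real^'n^'n"
    and w :: "nat \<Rightarrow> 'a \<Rightarrow> real^'n"
    and \<sigma> :: "nat \<Rightarrow> nat \<Rightarrow> 'a \<Rightarrow> real"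
  assumes "prob_space P"
    and "pos_def (transpose (hcat C D) ** hcat C D)"
    and "\<And>k. w k \<in> borel_measurable P"
    and "\<And>k. integrable P (\<lambda>\<omega>. (norm (w k \<omega>))\<^sup>2)"
    and "\<And>k. (\<integral>\<omega>. w k \<omega> \<partial>P) = 0"
    and "\<And>k. (\<integral>\<omega>. outer (w k \<omega>) (w k \<omega>) \<partial>P) = mat 1"
    and "\<And>k i. i \<in> {1..M} \<Longrightarrow> \<sigma> k i \<in> borel_measurable P"
    and "\<And>k i. i \<in> {1..M} \<Longrightarrow> integrable P (\<lambda>\<omega>. (\<sigma> k i \<omega>)\<^sup>2)"
    and "\<And>k i. i \<in> {1..M} \<Longrightarrow> (\<integral>\<omega>. \<sigma> k i \<omega> \<partial>P) = 0"
    and "\<And>k i. i \<in> {1..M} \<Longrightarrow> (\<integral>\<omega>. (\<sigma> k i \<omega>)\<^sup>2 \<partial>P) = 1"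
    and "independent_noise P M w \<sigma>"
  shows "(\<lambda>N. optimal_cost P A B C D M As w \<sigma> N) \<longlonglongrightarrow> sdp_value A B C D M As \<and>
    (\<forall>(X :: real^'n^'n) (R :: real^'m^'n) (U :: real^'m^'m).
       sdp_optimal A B C D M As (vcat (hcat X R) (hcat (transpose R) U)) \<longrightarrow>
         pos_def X \<and>
         (let \<mu> = linear_policy (transpose R ** matrix_inv X) in
            (\<forall>N. admissible P A B M As w \<sigma> N \<mu>) \<and>
            (\<lambda>N. ereal (average_cost P A B C D M As w \<sigma> N \<mu>))
              \<longlonglongrightarrow> lim (\<lambda>N. optimal_cost P A B C D M As w \<sigma> N)))"
proof -
  interpret controlled_noise P M w \<sigma> A B As
    using assms by (intro controlled_noise.intro noise.intro noise_axioms.intro)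
  note conv = optimal_cost_tendsto[OF assms(2)]
  show ?thesis
  proof (intro conjI allI impI)
    fix X :: "real^'n^'n" and R :: "real^'m^'n" and U :: "real^'m^'m"
    assume opt: "sdp_optimal A B C D M As (vcat (hcat X R) (hcat (transpose R) U))"
    then have V: "sdp_feasible A B M As (vcat (hcat X R) (hcat (transpose R) U))"
      by (simp add: sdp_optimal_def)
    show "pos_def X" by (rule pos_def_of_feasible[OF V])
    show "let \<mu> = linear_policy (transpose R ** matrix_inv X) in
            (\<forall>N. admissible P A B M As w \<sigma> N \<mu>) \<and>
            (\<lambda>N. ereal (average_cost P A B C D M As w \<sigma> N \<mu>))
              \<longlonglongrightarrow> lim (\<lambda>N. optimal_cost P A B C D M As w \<sigma> N)"
      \<comment> \<open>\<open>limI\<close> identifies the limit of the optimal costs with the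
        semidefinite value.\<close>
      using linear_policy_bound(1)[OF V] linear_policy_optimal[OF assms(2) opt]
      unfolding Let_def limI[OF conv] by blast
  qed (rule conv)
qed

end
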